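(* Let $\mathscr{A}\subset k[\boldsymbol{x}^{\pm1}]$ be the $k$-subalgebra constructed in the context from the data $C, C_1,\dots,C_r, R, I,\phi_1,\dots,\phi_r,U$. Let $\preceq\,\in\Omega$ be such that $\min_{\preceq}\bigl(\deg_{\preceq}\phi_i(R)\bigr)=\mathbf{0}$ for some $1\le i\le r$ (i.e. the minimum exists and equals $\mathbf 0$). Then the monoid $\deg_{\preceq}\mathscr{A}$ is not finitely generated.
   Context: Let $k$ be a field, $n\ge1$, and $k[\boldsymbol{x}^{\pm1}]=k[x_1,\dots,x_n,x_1^{-1},\dots,x_n^{-1}]$. For $\mathbf a=(a_1,\dots,a_n)\in\mathbb{Z}^n$ write $\boldsymbol{x}^{\mathbf a}=x_1^{a_1}\cdots x_n^{a_n}$. For $f=\sum_{\mathbf a}u_{\mathbf a}\boldsymbol{x}^{\mathbf a}$ with $u_{\mathbf a}\in k$, set $\operatorname{supp} f=\{\mathbf a\mid u_{\mathbf a}\neq0\}$; for $V\subset k[\boldsymbol{x}^{\pm1}]$ set $\operatorname{supp}V=\bigcup_{f\in V\setminus\{0\}}\operatorname{supp}f$. $\Omega$ is the set of total orders $\preceq$ on $\mathbb{Z}^n$ such that $\mathbf a\preceq\mathbf b$ implies $\mathbf a+\mathbf c\preceq\mathbf b+\mathbf c$ for all $\mathbf a,\mathbf b,\mathbf c\in\mathbb{Z}^n$. For $\preceq\,\in\Omega$, $\deg_{\preceq}f=\max_{\preceq}(\operatorname{supp}f)$ for $f\ne0$, and $\deg_{\preceq}V=\{\deg_{\preceq}f\mid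 f\in V\setminus\{0\}\}$. If $A$ is a $k$-subalgebra, $\deg_{\preceq}A$ is an additive submonoid of $\mathbb{Z}^n$. A convex cone in $\mathbb{R}^n$ is a nonempty subset $C$ with $\alpha\mathbf a+\beta\mathbf b\in C$ for all $\alpha,\beta\ge0$, $\mathbf a,\mathbf b\in C$. A subset $F\subset C$ is a face of $C$ if there is $\omega\in\mathbb{R}^n$ (a normal vector of $F$) with $F=\{\mathbf a\in C\mid\omega\cdot\mathbf a=0\}$ and $\omega\cdot\mathbf a\ge0$ for all $\mathbf a\in C$ (standard inner product). Construction. Let $C\subset\mathbb{R}^n$ be a convex cone and $C_1,\dots,C_r$ ($r\ge2$) faces of $C$ such that $C_i\not\subset C_j$ whenever $i\ne j$. Put $C^{\circ}=C\setminus\bigcup_{i=1}^rC_i$ and $C_i^{\circ}=C_i\setminus\bigcup_{j\ne i}C_j$. Let: - $R$ be a finitely generated $k$-domain (a $k$-algebra that is an integral domain) and $I\neq\{0\}$ an ideal of $R$ with $R=k+I$; - $\phi_1,\dots,\phi_r:R\to k[\boldsymbol{x}^{\pm1}]$ be injective homomorphisms of $k$-algebras with $\operatorname{supp}\phi_i(I)\subset C_i^{\circ}$ for $i=1,\dots,r$; - $U\subset k[\boldsymbol{x}^{\pm1}]$ be a finite (possibly empty) subset with $\operatorname{supp}U\subset C^{\circ}$. Let $\mathscr{B}=k[\phi_1(I)\cup\dots\cup\phi_r(I)\cup U]$ and let $J$ be the ideal of $\mathscr{B}$ generated by $\bigcup_{1\le i_1<i_2\le r}\phi_{i_1}(I)\phi_{i_2}(I)\cup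 U$. Let $\phi=\phi_1+\dots+\phi_r:R\to k[\boldsymbol{x}^{\pm1}]$ (a $k$-linear map). Choose $r_1,\dots,r_N\in I\setminus\{0\}$ ($N\ge1$) with $R=k[r_1,\dots,r_N]$, and define $\mathscr{A}=k[\phi(r_1),\dots,\phi(r_N)]+J$. This is a $k$-subalgebra of $k[\boldsymbol{x}^{\pm1}]$ equal to $k+\phi(I)+J$, hence independent of the choice of $r_1,\dots,r_N$. *)

theory Defs
  imports "HOL-Analysis.Analysis" "HOL-Library.Poly_Mapping"
begin

section \<open>Algebras over a field\<close>

text \<open>The \<open>k\<close>-algebra structure is carried by an explicit scalar multiplication, on top of the
  ring structure given by the type class.\<close>

locale k_algebra = vector_space sc
  for sc :: "'k::field \<Rightarrow> 'a::comm_ring_1 \<Rightarrow> 'a" +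
  assumes scale_mult_left: "sc c x * y = sc c (x * y)"

locale k_algebra_hom =
  dom: k_algebra s1 + cod: k_algebra s2 + Vector_Spaces.linear s1 s2 f
  for s1 :: "'k::field \<Rightarrow> 'a::comm_ring_1 \<Rightarrow> 'a"
    and s2 :: "'k \<Rightarrow> 'b::comm_ring_1 \<Rightarrow> 'b"
    and f :: "'a \<Rightarrow> 'b" +
  assumes hom_one: "f 1 = 1"
    and hom_mult: "f (x * y) = f x * f y"

definition subalgebra :: "('k::field \<Rightarrow> 'a::comm_ring_1 \<Rightarrow> 'a) \<Rightarrow> 'a set \<Rightarrow> bool"
  where "subalgebra sc S \<longleftrightarrow>
    1 \<in> S \<and> (\<forall>x\<in>S. \<forall>y\<in>S. x + y \<in> S \<and> x * y \<in> S) \<and> (\<forall>c. \<forall>x\<in>S. sc c x \<in> S)"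

definition generated_subalgebra :: "('k::field \<Rightarrow> 'a::comm_ring_1 \<Rightarrow> 'a) \<Rightarrow> 'a set \<Rightarrow> 'a set"
  where "generated_subalgebra sc X = subalgebra sc hull X"

definition finitely_generated_algebra :: "('k::field \<Rightarrow> 'a::comm_ring_1 \<Rightarrow> 'a) \<Rightarrow> bool"
  where "finitely_generated_algebra sc \<longleftrightarrow>
    (\<exists>X. finite X \<and> generated_subalgebra sc X = UNIV)"

text \<open>Ideals of a subring \<open>B\<close> of the ambient ring; for \<open>B = UNIV\<close> these are the ideals of the
  whole ring. Closure under negation follows from closure under multiplication by \<open>-1 \<in> B\<close>.\<close>

definition ideal_of :: "'a::comm_ring_1 set \<Rightarrow> 'a set \<Rightarrow> bool"
  where "ideal_of B J \<longleftrightarrow>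
    J \<subseteq> B \<and> 0 \<in> J \<and> (\<forall>x\<in>J. \<forall>y\<in>J. x + y \<in> J) \<and> (\<forall>b\<in>B. \<forall>x\<in>J. b * x \<in> J)"

definition generated_ideal :: "'a::comm_ring_1 set \<Rightarrow> 'a set \<Rightarrow> 'a set"
  where "generated_ideal B X = ideal_of B hull X"


section \<open>Laurent polynomials\<close>

text \<open>The Laurent polynomial ring is the group algebra of the exponent group: finitely supported
  functions from exponent vectors to coefficients, with the convolution product.\<close>

type_synonym ('n, 'k) laurent = "(int ^ 'n) \<Rightarrow>\<^sub>0 'k"

definition lscale :: "'k::field \<Rightarrow> ('n::finite, 'k) laurent \<Rightarrow> ('n, 'k) laurent"
  where "lscale c f = Poly_Mapping.map ((*) c) f"

lemma k_algebra_lscale: "k_algebra (lscale :: 'k::field \<Rightarrow> ('n::finite, 'k) laurent \<Rightarrow> _)"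
proof -
  have *: "lscale c f = Poly_Mapping.single 0 c * f" for c and f :: "('n, 'k) laurent"
    by (simp add: lscale_def mult_map_scale_conv_mult)
  show ?thesis
    by unfold_locales
      (simp_all add: * distrib_left single_add distrib_right mult_single mult.assoc [symmetric])
qed

definition supp :: "('n::finite, 'k::field) laurent set \<Rightarrow> (int ^ 'n) set"
  where "supp V = (\<Union>f \<in> V - {0}. Poly_Mapping.keys f)"

definition real_vec :: "int ^ 'n \<Rightarrow> real ^ 'n::finite"
  where "real_vec a = (\<chi> i. real_of_int (a $ i))"


section \<open>Monomial orders, degrees and monoids\<close>

definition Omega :: "(int ^ 'n::finite \<Rightarrow> int ^ 'n \<Rightarrow> bool) set"
  where "Omega = {le. reflp le \<and> antisymp le \<and> transp le \<and> totalp le \<and>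
    (\<forall>a b c. le a b \<longrightarrow> le (a + c) (b + c))}"

definition is_min :: "('a \<Rightarrow> 'a \<Rightarrow> bool) \<Rightarrow> 'a set \<Rightarrow> 'a \<Rightarrow> bool"
  where "is_min le S m \<longleftrightarrow> m \<in> S \<and> (\<forall>a\<in>S. le m a)"

definition is_max :: "('a \<Rightarrow> 'a \<Rightarrow> bool) \<Rightarrow> 'a set \<Rightarrow> 'a \<Rightarrow> bool"
  where "is_max le S m \<longleftrightarrow> m \<in> S \<and> (\<forall>a\<in>S. le a m)"

text \<open>Meaningful only for \<open>f \<noteq> 0\<close>.\<close>

definition deg :: "(int ^ 'n \<Rightarrow> int ^ 'n \<Rightarrow> bool) \<Rightarrow> ('n::finite, 'k::field) laurent \<Rightarrow> int ^ 'n"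
  where "deg le f = (THE a. is_max le (Poly_Mapping.keys f) a)"

definition deg_set ::
    "(int ^ 'n \<Rightarrow> int ^ 'n \<Rightarrow> bool) \<Rightarrow> ('n::finite, 'k::field) laurent set \<Rightarrow> (int ^ 'n) set"
  where "deg_set le V = deg le ` (V - {0})"

definition submonoid :: "'a::comm_monoid_add set \<Rightarrow> bool"
  where "submonoid M \<longleftrightarrow> 0 \<in> M \<and> (\<forall>a\<in>M. \<forall>b\<in>M. a + b \<in> M)"

definition finitely_generated_monoid :: "'a::comm_monoid_add set \<Rightarrow> bool"
  where "finitely_generated_monoid M \<longleftrightarrow> (\<exists>S. finite S \<and> submonoid hull S = M)"


section \<open>Faces of cones\<close>

text \<open>The library notion \<^const>\<open>face_of\<close> is different: here a face is cut out by a supporting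
  hyperplane through the origin (and \<open>C\<close> itself is a face, with normal vector \<open>0\<close>).\<close>

definition cone_face :: "(real ^ 'n::finite) set \<Rightarrow> (real ^ 'n) set \<Rightarrow> bool"
  where "cone_face F C \<longleftrightarrow> (\<exists>w. F = {a \<in> C. w \<bullet> a = 0} \<and> (\<forall>a\<in>C. w \<bullet> a \<ge> 0))"

definition cone_circ :: "nat \<Rightarrow> (real ^ 'n::finite) set \<Rightarrow> (nat \<Rightarrow> (real ^ 'n) set) \<Rightarrow> (real ^ 'n) set"
  where "cone_circ r C Cf = C - (\<Union>i\<in>{1..r}. Cf i)"

definition face_circ :: "nat \<Rightarrow> (nat \<Rightarrow> (real ^ 'n::finite) set) \<Rightarrow> nat \<Rightarrow> (real ^ 'n) set"
  where "face_circ r Cf i = Cf i - (\<Union>j\<in>{1..r} - {i}. Cf j)"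


section \<open>The construction\<close>

definition algB :: "nat \<Rightarrow> (nat \<Rightarrow> 'r \<Rightarrow> ('n::finite, 'k::field) laurent) \<Rightarrow> 'r set \<Rightarrow>
    ('n, 'k) laurent set \<Rightarrow> ('n, 'k) laurent set"
  where "algB r \<phi> I U = generated_subalgebra lscale ((\<Union>i\<in>{1..r}. \<phi> i ` I) \<union> U)"

text \<open>The product of \<open>\<phi> i ` I\<close> and \<open>\<phi> j ` I\<close> is taken elementwise; its linear span generates the
  same ideal.\<close>

definition idealJ :: "nat \<Rightarrow> (nat \<Rightarrow> 'r \<Rightarrow> ('n::finite, 'k::field) laurent) \<Rightarrow> 'r set \<Rightarrow>
    ('n, 'k) laurent set \<Rightarrow> ('n, 'k) laurent set"
  where "idealJ r \<phi> I U = generated_ideal (algB r \<phi> I U)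
    ({\<phi> i x * \<phi> j y | i j x y. 1 \<le> i \<and> i < j \<and> j \<le> r \<and> x \<in> I \<and> y \<in> I} \<union> U)"

definition phi_sum :: "nat \<Rightarrow> (nat \<Rightarrow> 'r \<Rightarrow> ('n::finite, 'k::field) laurent) \<Rightarrow>
    'r \<Rightarrow> ('n, 'k) laurent"
  where "phi_sum r \<phi> x = (\<Sum>i\<in>{1..r}. \<phi> i x)"

definition algA :: "nat \<Rightarrow> (nat \<Rightarrow> 'r \<Rightarrow> ('n::finite, 'k::field) laurent) \<Rightarrow> 'r set \<Rightarrow>
    ('n, 'k) laurent set \<Rightarrow> nat \<Rightarrow> (nat \<Rightarrow> 'r) \<Rightarrow> ('n, 'k) laurent set"
  where "algA r \<phi> I U N \<rho> =
    {a + b | a b. a \<in> generated_subalgebra lscale (phi_sum r \<phi> ` \<rho> ` {1..N}) \<and> b \<in> idealJ r \<phi> I U}"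

end

theory Submission
  imports Defs "HOL-Real_Asymp.Real_Asymp"
begin

text \<open>Each \<open>v\<^sub>i = deg \<circ> \<phi>\<^sub>i\<close> is a valuation on \<open>R\<close> whose leading coefficients lie in \<open>k\<close>, so a
  finite-dimensional subspace \<open>W\<close> has exactly \<open>dim W\<close> values, and the same holds for the maximum of
  two of them, since their values on \<open>I\<close> lie in different faces. Nonzero elements of \<open>deg A\<close> in the
  face \<open>C\<^sub>i\<close> are values \<open>v\<^sub>i h\<close> of elements \<open>h\<close> on which \<open>v\<^sub>i\<close> exceeds all other \<open>v\<^sub>l\<close>. If \<open>deg A\<close> were
  finitely generated, Dickson's lemma applied to the sums \<open>v\<^sub>i f + v\<^sub>l g \<in> deg J\<close> with \<open>g\<close> fixed would
  show that \<open>v\<^sub>i I\<close> is a finite union of translates of \<open>deg A \<inter> C\<^sub>i\<close>; in particular all \<open>v\<^sub>i\<close> are then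
  positive on \<open>I\<close>.

  Let \<open>N n\<close> be the number of values of \<open>max v\<^sub>1 v\<^sub>2\<close> up to \<open>n\<close> times the smallest generator. Each of
  these values is dominated by \<open>v\<^sub>1\<close> or by \<open>v\<^sub>2\<close>. By the dimension count there are at least \<open>N n\<close>
  values of each \<open>v\<^sub>i\<close> in this range. For one \<open>i\<close>, multiplication by a suitable element makes all of
  them dominant; for the other at least a fixed proportion \<open>1/c\<close> becomes dominant. Thus
  \<open>N (n + p) \<ge> (1 + 1/c) N n\<close>, whereas \<open>N\<close> has polynomial growth.\<close>

section \<open>Growth, Dickson's lemma and generated monoids\<close>

text \<open>Iterating \<open>growth\<close> along q, q + p, q + 2p, ... multiplies \<open>a\<close>
  by at least (c+1)/c > 1 each time. This exponential lower bound eventually exceeds any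
  polynomial.\<close>

lemma no_geometric_growth_of_poly_bounded:
  fixes a :: "nat \<Rightarrow> nat" and c p q d K :: nat
  assumes growth: "\<And>n. (c + 1) * a n \<le> c * a (n + p)"
    and "a q \<ge> 1"
    and bound: "\<And>n. a n \<le> K * (n + 1) ^ d"
  shows False
proof -
  \<comment> \<open>For c = 0 the inequality at q would force \<open>a q\<close> to be 0.\<close>
  have "c > 0"
    using growth[of q] assms(2) by (cases c) auto
  define x where "x = (real c + 1) / real c"
  have "x > 1"
    using \<open>c > 0\<close> by (simp add: x_def)
  have lower: "x ^ n \<le> real (a (q + n * p))" for n
  proof (induction n)
    case 0
    then show ?case using assms(2) by simp
  next
    case (Suc n)
    have "real ((c + 1) * a (q + n * p)) \<le> real (c * a (q + n * p + p))"
      using growth of_nat_le_iff by blast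
    then have "x * real (a (q + n * p)) \<le> real (a (q + Suc n * p))"
      using \<open>c > 0\<close> by (simp add: x_def field_simps)
    moreover have "x ^ Suc n \<le> x * real (a (q + n * p))"
      using Suc \<open>x > 1\<close> by simp
    ultimately show ?case by linarith
  qed
  define K' where "K' = real K * (real q + real p + 1) ^ d"
  have upper: "real (a (q + n * p)) \<le> K' * (real n + 1) ^ d" for n
  proof -
    have "q + n * p + 1 \<le> (q + p + 1) * (n + 1)"
      by (simp add: algebra_simps)
    then have "a (q + n * p) \<le> K * ((q + p + 1) * (n + 1)) ^ d"
      using bound[of "q + n * p"] by (meson mult_le_mono2 order_trans power_mono zero_le)
    then have "real (a (q + n * p)) \<le> real (K * ((q + p + 1) * (n + 1)) ^ d)"
      using of_nat_le_iff by blast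
    also have "\<dots> = K' * (real n + 1) ^ d"
      by (simp only: K'_def of_nat_mult of_nat_power of_nat_add of_nat_1 power_mult_distrib
          mult.assoc)
    finally show ?thesis .
  qed
  have "(\<lambda>n. K' * (real n + 1) ^ d / x ^ n) \<longlonglongrightarrow> 0"
    using \<open>x > 1\<close> by real_asymp
  then have "\<forall>\<^sub>F n in sequentially. K' * (real n + 1) ^ d / x ^ n < 1"
    by (rule order_tendstoD) simp
  then obtain n where "K' * (real n + 1) ^ d / x ^ n < 1"
    by (auto simp: eventually_sequentially)
  moreover have "x ^ n > 0"
    using \<open>x > 1\<close> by simp
  ultimately have "K' * (real n + 1) ^ d < x ^ n"
    by (simp add: field_simps)
  with lower[of n] upper[of n] show False by linarith
qed

text \<open>Dickson's lemma, with a multiset read as its vector of multiplicities on S. After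
  inserting s, take a finite basis Y for the other coordinates. A member of X whose s-multiplicity
  exceeds all those in Y is dominated by Y. The rest lie in finitely many slices of constant
  s-multiplicity, each with its own finite basis.\<close>

lemma dickson_multiset:
  fixes X :: "'a multiset set"
  assumes "finite S"
  shows "\<exists>Y\<subseteq>X. finite Y \<and> (\<forall>M\<in>X. \<exists>L\<in>Y. \<forall>s\<in>S. count L s \<le> count M s)"
  using assms
proof (induction S arbitrary: X rule: finite_induct)
  case empty
  show ?case
  proof (cases "X = {}")
    case False
    then obtain M where "M \<in> X" by blast
    then show ?thesis by (intro exI[of _ "{M}"]) auto
  qed auto
next
  case (insert s S)
  obtain Y where Y: "Y \<subseteq> X" "finite Y" "\<And>M. M \<in> X \<Longrightarrow> \<exists>L\<in>Y. \<forall>s\<in>S. count L s \<le> count M s"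
    using insert.IH[of X] by blast
  obtain m where m: "\<And>L. L \<in> Y \<Longrightarrow> count L s \<le> m"
    using finite_nat_set_iff_bounded_le[of "(\<lambda>L. count L s) ` Y"] Y(2) by auto
  have "\<forall>c. \<exists>Z\<subseteq>{M\<in>X. count M s = c}. finite Z \<and>
      (\<forall>M\<in>{M\<in>X. count M s = c}. \<exists>L\<in>Z. \<forall>s\<in>S. count L s \<le> count M s)"
    by (intro allI insert.IH)
  then obtain Z where Z: "\<forall>c. Z c \<subseteq> {M\<in>X. count M s = c} \<and> finite (Z c) \<and>
      (\<forall>M\<in>{M\<in>X. count M s = c}. \<exists>L\<in>Z c. \<forall>s\<in>S. count L s \<le> count M s)"
    by (rule choice[THEN exE])
  have Z1: "Z c \<subseteq> {M\<in>X. count M s = c}" and Z2: "finite (Z c)" for c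
    using Z by simp_all
  have Z3: "\<exists>L\<in>Z (count M s). \<forall>t\<in>S. count L t \<le> count M t" if "M \<in> X" for M
    using Z that by simp
  show ?case
  proof (intro exI[of _ "Y \<union> (\<Union>c\<le>m. Z c)"] conjI ballI)
    show "Y \<union> (\<Union>c\<le>m. Z c) \<subseteq> X" using Y(1) Z1 by blast
    show "finite (Y \<union> (\<Union>c\<le>m. Z c))" using Y(2) Z2 by simp
    fix M assume M: "M \<in> X"
    show "\<exists>L\<in>Y \<union> (\<Union>c\<le>m. Z c). \<forall>t\<in>insert s S. count L t \<le> count M t"
    proof (cases "count M s \<le> m")
      case True
      obtain L where L: "L \<in> Z (count M s)" "\<forall>t\<in>S. count L t \<le> count M t"
        using Z3[OF M] by blast
      moreover have "count L s = count M s" using Z1 L(1) by blast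
      ultimately show ?thesis using True by (intro bexI[of _ L]) auto
    next
      case False
      obtain L where "L \<in> Y" "\<forall>t\<in>S. count L t \<le> count M t" using Y(3)[OF M] by blast
      with m[of L] False show ?thesis by (intro bexI[of _ L]) auto
    qed
  qed
qed

text \<open>A multiset over T is given by its multiplicities, each one of n + 1 numbers. The crude
  bound suffices, since only polynomial growth in n matters later.\<close>

lemma card_bounded_multisets:
  assumes "finite T"
  shows "finite {M. set_mset M \<subseteq> T \<and> size M \<le> n}"
    and "card {M. set_mset M \<subseteq> T \<and> size M \<le> n} \<le> (n + 1) ^ card T"
proof -
  let ?A = "{M. set_mset M \<subseteq> T \<and> size M \<le> n}" and ?B = "T \<rightarrow>\<^sub>E {..n}"
  let ?f = "\<lambda>M. restrict (count M) T"
  have inj: "inj_on ?f ?A"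
  proof (rule inj_onI)
    fix M L assume "M \<in> ?A" "L \<in> ?A" and eq: "?f M = ?f L"
    then have "count M t = count L t" for t
    proof (cases "t \<in> T")
      case True
      with eq show ?thesis by (metis restrict_apply')
    next
      case False
      with \<open>M \<in> ?A\<close> \<open>L \<in> ?A\<close> have "t \<notin># M" "t \<notin># L" by auto
      then show ?thesis by (simp add: not_in_iff)
    qed
    then show "M = L" by (rule multiset_eqI)
  qed
  have sub: "?f ` ?A \<subseteq> ?B"
  proof
    fix h assume "h \<in> ?f ` ?A"
    then obtain M where "h = ?f M" "size M \<le> n" by blast
    moreover have "count M t \<le> size M" for t by (rule count_le_size)
    ultimately show "h \<in> ?B" by (auto intro: order_trans)
  qed
  have fin: "finite ?B" using assms by (simp add: finite_PiE)
  show "finite ?A" by (rule inj_on_finite[OF inj sub fin])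
  have "card ?A \<le> card ?B" by (rule card_inj_on_le[OF inj sub fin])
  also have "\<dots> = (n + 1) ^ card T" using assms by (simp add: card_PiE)
  finally show "card ?A \<le> (n + 1) ^ card T" .
qed

primrec nat_mult :: "nat \<Rightarrow> 'a::monoid_add \<Rightarrow> 'a" where
  "nat_mult 0 x = 0"
| "nat_mult (Suc n) x = x + nat_mult n x"

lemma nat_mult_add: "nat_mult (m + n) x = nat_mult m x + nat_mult n x"
  by (induction m) (simp_all add: add.assoc)

text \<open>Zero summands are dropped at once, so that later every summand from a face can be shown
  to be strictly positive.\<close>

lemma mem_submonoid_hull_imp_sum_mset:
  assumes "a \<in> submonoid hull S"
  shows "\<exists>M. set_mset M \<subseteq> S - {0} \<and> a = sum_mset M"
proof (rule hull_induct[OF assms])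
  show "\<exists>M. set_mset M \<subseteq> S - {0} \<and> x = sum_mset M" if "x \<in> S" for x
  proof (cases "x = 0")
    case True then show ?thesis by (intro exI[of _ "{#}"]) simp
  next
    case False with that show ?thesis by (intro exI[of _ "{#x#}"]) simp
  qed
  have "\<exists>N. set_mset N \<subseteq> S - {0} \<and> 0 = sum_mset N"
    by (intro exI[of _ "{#}"]) simp
  moreover have "\<exists>N. set_mset N \<subseteq> S - {0} \<and> sum_mset M + sum_mset L = sum_mset N"
    if "set_mset M \<subseteq> S - {0}" "set_mset L \<subseteq> S - {0}" for M L
    using that by (intro exI[of _ "M + L"]) simp
  ultimately show "submonoid {x. \<exists>M. set_mset M \<subseteq> S - {0} \<and> x = sum_mset M}"
    unfolding submonoid_def by (simp, metis)
qed

lemma subalgebra_generated_subalgebra: "subalgebra sc (generated_subalgebra sc X)"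
  unfolding generated_subalgebra_def
  by (rule hull_in) (auto simp: subalgebra_def)

section \<open>Ordered abelian groups\<close>

locale ordered_group =
  fixes le :: "'g::ab_group_add \<Rightarrow> 'g \<Rightarrow> bool" (infix "\<sqsubseteq>" 50)
  assumes le_refl: "x \<sqsubseteq> x"
    and le_antisym: "x \<sqsubseteq> y \<Longrightarrow> y \<sqsubseteq> x \<Longrightarrow> x = y"
    and le_trans: "x \<sqsubseteq> y \<Longrightarrow> y \<sqsubseteq> z \<Longrightarrow> x \<sqsubseteq> z"
    and le_total: "x \<sqsubseteq> y \<or> y \<sqsubseteq> x"
    and le_add: "x \<sqsubseteq> y \<Longrightarrow> x + z \<sqsubseteq> y + z"
begin

definition lt (infix "\<sqsubset>" 50)
  where "x \<sqsubset> y \<longleftrightarrow> x \<sqsubseteq> y \<and> x \<noteq> y"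

sublocale og: linordered_ab_group_add "(+)" 0 "(-)" uminus le lt
  by unfold_locales
    (auto simp: lt_def le_refl le_total intro: le_antisym le_trans dest: le_add simp: add.commute)

lemma nat_mult_pos: "0 \<sqsubset> x \<Longrightarrow> n > 0 \<Longrightarrow> 0 \<sqsubset> nat_mult n x"
proof (induction n)
  case (Suc n)
  then show ?case by (cases "n = 0") (auto intro: og.add_pos_pos)
qed simp

lemma nat_mult_neg: "x \<sqsubset> 0 \<Longrightarrow> n > 0 \<Longrightarrow> nat_mult n x \<sqsubset> 0"
proof (induction n)
  case (Suc n)
  then show ?case by (cases "n = 0") (auto intro: og.add_neg_neg)
qed simp

lemma nat_mult_nonneg: "0 \<sqsubseteq> x \<Longrightarrow> 0 \<sqsubseteq> nat_mult n x"
  by (induction n) (auto intro: og.add_nonneg_nonneg le_refl)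

lemma nat_mult_mono: "0 \<sqsubseteq> x \<Longrightarrow> m \<le> n \<Longrightarrow> nat_mult m x \<sqsubseteq> nat_mult n x"
  using og.add_left_mono[OF nat_mult_nonneg[of x "n - m"], of "nat_mult m x"]
  by (metis add.right_neutral le_add_diff_inverse nat_mult_add)

lemma nat_mult_le_imp_le: "0 \<sqsubset> x \<Longrightarrow> nat_mult m x \<sqsubseteq> nat_mult n x \<Longrightarrow> m \<le> n"
proof (rule ccontr)
  assume x: "0 \<sqsubset> x" "nat_mult m x \<sqsubseteq> nat_mult n x" and "\<not> m \<le> n"
  then have "nat_mult m x = nat_mult n x + nat_mult (m - n) x"
    by (metis le_add_diff_inverse nat_le_linear nat_mult_add)
  moreover have "0 \<sqsubset> nat_mult (m - n) x"
    using x(1) \<open>\<not> m \<le> n\<close> by (intro nat_mult_pos) auto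
  ultimately have "nat_mult n x \<sqsubset> nat_mult m x"
    using og.less_add_same_cancel1 by metis
  with x(2) show False by (simp add: og.leD)
qed

lemma sum_mset_nonneg:
  assumes "\<And>x. x \<in># M \<Longrightarrow> 0 \<sqsubseteq> x"
  shows "0 \<sqsubseteq> sum_mset M"
  using assms by (induction M) (auto intro: og.add_nonneg_nonneg le_refl)

lemma sum_mset_pos:
  assumes "M \<noteq> {#}" "\<And>x. x \<in># M \<Longrightarrow> 0 \<sqsubset> x"
  shows "0 \<sqsubset> sum_mset M"
proof -
  obtain x L where M: "M = add_mset x L" using assms(1) by (cases M) auto
  have "0 \<sqsubseteq> sum_mset L"
    using assms(2) M by (intro sum_mset_nonneg) (auto simp: lt_def)
  moreover have "0 \<sqsubset> x" using assms(2) M by auto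
  ultimately show ?thesis by (simp add: M og.add_pos_nonneg)
qed

lemma sum_mset_lower_bound:
  assumes "\<And>x. x \<in># M \<Longrightarrow> d \<sqsubseteq> x"
  shows "nat_mult (size M) d \<sqsubseteq> sum_mset M"
  using assms by (induction M) (auto intro: og.add_mono le_refl)

lemma finite_has_max:
  assumes "finite A" "A \<noteq> {}"
  shows "\<exists>m\<in>A. \<forall>a\<in>A. a \<sqsubseteq> m"
  using assms by (induction A rule: finite_ne_induct) (auto intro: le_refl, metis le_total le_trans)

lemma finite_has_min:
  assumes "finite A" "A \<noteq> {}"
  shows "\<exists>m\<in>A. \<forall>a\<in>A. m \<sqsubseteq> a"
  using assms by (induction A rule: finite_ne_induct) (auto intro: le_refl, metis le_total le_trans)

end

section \<open>Valuations\<close>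

locale valued_algebra = ordered_group le + k_algebra sc
  for le :: "'g::ab_group_add \<Rightarrow> 'g \<Rightarrow> bool" (infix "\<sqsubseteq>" 50)
    and sc :: "'k::field \<Rightarrow> 'a::idom \<Rightarrow> 'a"
begin

text \<open>The sign convention is that of degrees. The last clause says that the residue field is
  the field of scalars.\<close>

definition valuation :: "('a \<Rightarrow> 'g) \<Rightarrow> bool"
  where "valuation v \<longleftrightarrow>
    (\<forall>f g. f \<noteq> 0 \<longrightarrow> g \<noteq> 0 \<longrightarrow> v (f * g) = v f + v g) \<and>
    (\<forall>f g. f \<noteq> 0 \<longrightarrow> g \<noteq> 0 \<longrightarrow> f + g \<noteq> 0 \<longrightarrow> v (f + g) \<sqsubseteq> v f \<or> v (f + g) \<sqsubseteq> v g) \<and>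
    (\<forall>c f. c \<noteq> 0 \<longrightarrow> f \<noteq> 0 \<longrightarrow> v (sc c f) = v f) \<and>
    (\<forall>f g. f \<noteq> 0 \<longrightarrow> g \<noteq> 0 \<longrightarrow> v f = v g \<longrightarrow> (\<exists>c. f = sc c g \<or> v (f - sc c g) \<sqsubset> v f))"

lemma valuation_mult: "valuation v \<Longrightarrow> f \<noteq> 0 \<Longrightarrow> g \<noteq> 0 \<Longrightarrow> v (f * g) = v f + v g"
  by (simp add: valuation_def)

lemma valuation_add:
  "valuation v \<Longrightarrow> f \<noteq> 0 \<Longrightarrow> g \<noteq> 0 \<Longrightarrow> f + g \<noteq> 0 \<Longrightarrow> v (f + g) \<sqsubseteq> v f \<or> v (f + g) \<sqsubseteq> v g"
  by (simp add: valuation_def)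

lemma valuation_scale: "valuation v \<Longrightarrow> c \<noteq> 0 \<Longrightarrow> f \<noteq> 0 \<Longrightarrow> v (sc c f) = v f"
  by (simp add: valuation_def)

lemma valuation_leading_term:
  "valuation v \<Longrightarrow> f \<noteq> 0 \<Longrightarrow> g \<noteq> 0 \<Longrightarrow> v f = v g \<Longrightarrow> \<exists>c. f = sc c g \<or> v (f - sc c g) \<sqsubset> v f"
  by (simp add: valuation_def)

lemma subspace_valuation_less:
  assumes v: "valuation v"
  shows "subspace {f. f = 0 \<or> v f \<sqsubset> x}"
proof (rule subspaceI)
  fix f g assume "f \<in> {f. f = 0 \<or> v f \<sqsubset> x}" "g \<in> {f. f = 0 \<or> v f \<sqsubset> x}"
  then show "f + g \<in> {f. f = 0 \<or> v f \<sqsubset> x}"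
    using valuation_add[OF v, of f g] og.le_less_trans[of "v (f + g)" "v f" x]
      og.le_less_trans[of "v (f + g)" "v g" x]
    by (cases "f = 0"; cases "g = 0") auto
next
  fix c f assume "f \<in> {f. f = 0 \<or> v f \<sqsubset> x}"
  then show "sc c f \<in> {f. f = 0 \<or> v f \<sqsubset> x}"
    using valuation_scale[OF v, of c f] by (cases "c = 0"; cases "f = 0") auto
qed simp

lemma subspace_valuation_le:
  assumes v: "valuation v"
  shows "subspace {f. f = 0 \<or> v f \<sqsubseteq> x}"
proof (rule subspaceI)
  fix f g assume "f \<in> {f. f = 0 \<or> v f \<sqsubseteq> x}" "g \<in> {f. f = 0 \<or> v f \<sqsubseteq> x}"
  then show "f + g \<in> {f. f = 0 \<or> v f \<sqsubseteq> x}"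
    using valuation_add[OF v, of f g] le_trans[of "v (f + g)" "v f" x]
      le_trans[of "v (f + g)" "v g" x]
    by (cases "f = 0"; cases "g = 0") auto
next
  fix c f assume "f \<in> {f. f = 0 \<or> v f \<sqsubseteq> x}"
  then show "sc c f \<in> {f. f = 0 \<or> v f \<sqsubseteq> x}"
    using valuation_scale[OF v, of c f] by (cases "c = 0"; cases "f = 0") auto
qed simp

text \<open>Add the representatives by increasing value: the earlier ones span a subspace of
  elements of value below x, which misses the next one. The hypothesis speaks of sublevel sets
  rather than of valuations so that it also covers the maximum of two valuations.\<close>

lemma independent_distinct_values:
  assumes less: "\<And>x. subspace {f. f = 0 \<or> u f \<sqsubset> x}"
    and "finite X"
    and w: "\<And>x. x \<in> X \<Longrightarrow> w x \<noteq> 0 \<and> u (w x) = x"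
  shows "independent (w ` X)"
  using \<open>finite X\<close> w
proof (induction X rule: og.finite_linorder_max_induct)
  case (insert x X)
  have "w ` X \<subseteq> {f. f = 0 \<or> u f \<sqsubset> x}"
    using insert by auto
  then have "span (w ` X) \<subseteq> {f. f = 0 \<or> u f \<sqsubset> x}"
    by (intro span_minimal less)
  moreover have "w x \<noteq> 0" "u (w x) = x"
    using insert.prems by auto
  ultimately have "w x \<notin> span (w ` X)" by auto
  moreover have "independent (w ` X)"
    using insert by blast
  ultimately show ?case by (simp add: independent_insertI)
qed (simp add: independent_empty)

text \<open>Subtracting a suitable multiple of the representative with the same value lowers the
  value of f, because the residue field is the field of scalars. This stops, as W has only finitely
  many values.\<close>

lemma span_value_representatives:
  assumes v: "valuation v" and W: "subspace W" and fin: "finite (v ` (W - {0}))"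
    and w: "\<And>y. y \<in> v ` (W - {0}) \<Longrightarrow> w y \<in> W - {0} \<and> v (w y) = y"
  shows "W \<subseteq> span (w ` v ` (W - {0}))"
proof
  let ?Y = "v ` (W - {0})"
  fix f assume "f \<in> W"
  then show "f \<in> span (w ` ?Y)"
  proof (induction "card {y \<in> ?Y. y \<sqsubset> v f}" arbitrary: f rule: less_induct)
    case less
    show ?case
    proof (cases "f = 0")
      case True then show ?thesis by (simp add: span_zero)
    next
      case False
      let ?g = "w (v f)"
      have vf: "v f \<in> ?Y" using less.prems False by auto
      then have g: "?g \<in> W" "?g \<noteq> 0" "v ?g = v f" using w by auto
      have gs: "?g \<in> span (w ` ?Y)" using vf by (auto intro: span_base)
      obtain c where c: "f = sc c ?g \<or> v (f - sc c ?g) \<sqsubset> v f"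
        using valuation_leading_term[OF v False g(2)] g(3) by metis
      have "f - sc c ?g \<in> span (w ` ?Y)"
      proof (cases "f - sc c ?g = 0")
        case True then show ?thesis by (simp add: span_zero)
      next
        case nz: False
        then have lt: "v (f - sc c ?g) \<sqsubset> v f" using c by auto
        have mem: "f - sc c ?g \<in> W"
          using W less.prems g(1) by (intro subspace_diff subspace_scale) auto
        have "v (f - sc c ?g) \<in> ?Y" using mem nz by auto
        then have "{y \<in> ?Y. y \<sqsubset> v (f - sc c ?g)} \<subset> {y \<in> ?Y. y \<sqsubset> v f}"
          using lt by (auto intro: og.less_trans)
        then have "card {y \<in> ?Y. y \<sqsubset> v (f - sc c ?g)} < card {y \<in> ?Y. y \<sqsubset> v f}"
          using fin by (intro psubset_card_mono) auto
        then show ?thesis using less.hyps mem by blast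
      qed
      then have "(f - sc c ?g) + sc c ?g \<in> span (w ` ?Y)"
        using gs by (intro span_add span_scale)
      then show ?thesis by simp
    qed
  qed
qed

text \<open>The left-hand side is at most \<open>dim W\<close>, the right-hand side is equal to it.\<close>

lemma card_values_le:
  assumes less: "\<And>x. subspace {f. f = 0 \<or> u f \<sqsubset> x}" and fin_u: "finite (u ` (W - {0}))"
    and v: "valuation v" and W: "subspace W" and fin: "finite (v ` (W - {0}))"
  shows "card (u ` (W - {0})) \<le> card (v ` (W - {0}))"
proof -
  obtain a where a: "\<And>x. x \<in> u ` (W - {0}) \<Longrightarrow> a x \<in> W - {0} \<and> u (a x) = x"
    using that[of "inv_into (W - {0}) u"] by (metis f_inv_into_f inv_into_into)
  obtain w where w: "\<And>y. y \<in> v ` (W - {0}) \<Longrightarrow> w y \<in> W - {0} \<and> v (w y) = y"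
    using that[of "inv_into (W - {0}) v"] by (metis f_inv_into_f inv_into_into)
  have "independent (a ` u ` (W - {0}))"
    using a by (intro independent_distinct_values[OF less fin_u]) auto
  moreover have "a ` u ` (W - {0}) \<subseteq> span (w ` v ` (W - {0}))"
    using span_value_representatives[OF v W fin w] a by blast
  ultimately have "card (a ` u ` (W - {0})) \<le> card (w ` v ` (W - {0}))"
    using fin by (intro independent_span_bound[THEN conjunct2]) auto
  also have "\<dots> \<le> card (v ` (W - {0}))"
    by (rule card_image_le[OF fin])
  also have "card (a ` u ` (W - {0})) = card (u ` (W - {0}))"
    using a by (intro card_image inj_onI) metis
  finally show ?thesis .
qed

end

section \<open>Two competing valuations\<close>

text \<open>The assumptions are contradictory; this is the core of the argument.\<close>

locale valuation_pair = valued_algebra le sc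
  for le :: "'g::ab_group_add \<Rightarrow> 'g \<Rightarrow> bool" (infix "\<sqsubseteq>" 50)
    and sc :: "'k::field \<Rightarrow> 'a::idom \<Rightarrow> 'a" +
  fixes V :: "'a set" and T :: "'g set" and \<delta> :: 'g and v\<^sub>1 v\<^sub>2 :: "'a \<Rightarrow> 'g" and F\<^sub>1 F\<^sub>2 :: "'a set"
  assumes val1: "valuation v\<^sub>1" and val2: "valuation v\<^sub>2"
    and subspace_V: "subspace V"
    and mult_V: "f \<in> V \<Longrightarrow> g \<in> V \<Longrightarrow> f * g \<in> V"
    and nonzero_V: "V \<noteq> {0}"
    and disjoint_values: "f \<in> V - {0} \<Longrightarrow> g \<in> V - {0} \<Longrightarrow> v\<^sub>1 f \<noteq> v\<^sub>2 g"
    and pos1: "f \<in> V - {0} \<Longrightarrow> 0 \<sqsubset> v\<^sub>1 f" and pos2: "f \<in> V - {0} \<Longrightarrow> 0 \<sqsubset> v\<^sub>2 f"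
    and finite_T: "finite T"
    and T_ge: "t \<in> T \<Longrightarrow> \<delta> \<sqsubseteq> t" and \<delta>_pos: "0 \<sqsubset> \<delta>"
    and archimedean: "f \<in> V - {0} \<Longrightarrow> \<exists>n. v\<^sub>1 f \<sqsubseteq> nat_mult n \<delta> \<and> v\<^sub>2 f \<sqsubseteq> nat_mult n \<delta>"
    and F1: "finite F\<^sub>1" "F\<^sub>1 \<subseteq> V - {0}" and F2: "finite F\<^sub>2" "F\<^sub>2 \<subseteq> V - {0}"
    and cover1: "f \<in> V - {0} \<Longrightarrow> \<exists>g\<in>F\<^sub>1. \<exists>M. set_mset M \<subseteq> T \<and> v\<^sub>1 f = v\<^sub>1 g + sum_mset M \<and>
      (M = {#} \<or> (\<exists>h\<in>V - {0}. v\<^sub>1 h = sum_mset M \<and> v\<^sub>2 h \<sqsubset> v\<^sub>1 h))"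
    and cover2: "f \<in> V - {0} \<Longrightarrow> \<exists>g\<in>F\<^sub>2. \<exists>M. set_mset M \<subseteq> T \<and> v\<^sub>2 f = v\<^sub>2 g + sum_mset M \<and>
      (M = {#} \<or> (\<exists>h\<in>V - {0}. v\<^sub>2 h = sum_mset M \<and> v\<^sub>1 h \<sqsubset> v\<^sub>2 h))"
begin

text \<open>The assumptions are symmetric in the two valuations, so every result about the first one
  is available for the second.\<close>

lemma swap: "valuation_pair le sc V T \<delta> v\<^sub>2 v\<^sub>1 F\<^sub>2 F\<^sub>1"
proof -
  have disjoint: "v\<^sub>2 f \<noteq> v\<^sub>1 g" if "f \<in> V - {0}" "g \<in> V - {0}" for f g
    using disjoint_values[OF that(2,1)] by simp
  have arch: "\<exists>n. v\<^sub>2 f \<sqsubseteq> nat_mult n \<delta> \<and> v\<^sub>1 f \<sqsubseteq> nat_mult n \<delta>" if "f \<in> V - {0}" for f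
    using archimedean[OF that] by auto
  show ?thesis
    by unfold_locales
      (fact val1 val2 subspace_V mult_V nonzero_V disjoint pos1 pos2 finite_T T_ge \<delta>_pos
        arch F1 F2 cover1 cover2)+
qed

text \<open>The maximum need not be additive on products, but its sublevel sets are still subspaces,
  which is all that the dimension count asks of it.\<close>

definition vmax :: "'a \<Rightarrow> 'g"
  where "vmax f = (if v\<^sub>1 f \<sqsubset> v\<^sub>2 f then v\<^sub>2 f else v\<^sub>1 f)"

definition bounded :: "'g set \<Rightarrow> nat \<Rightarrow> 'g set"
  where "bounded X n = {x \<in> X. x \<sqsubseteq> nat_mult n \<delta>}"

definition dominant\<^sub>1 :: "'g set"
  where "dominant\<^sub>1 = {v\<^sub>1 f | f. f \<in> V - {0} \<and> v\<^sub>2 f \<sqsubset> v\<^sub>1 f}"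

definition dominant\<^sub>2 :: "'g set"
  where "dominant\<^sub>2 = {v\<^sub>2 f | f. f \<in> V - {0} \<and> v\<^sub>1 f \<sqsubset> v\<^sub>2 f}"

text \<open>By \<open>disjoint_values\<close> the two values of an element never tie, so one of them
  strictly dominates.\<close>

lemma vmax_image: "vmax ` (V - {0}) = dominant\<^sub>1 \<union> dominant\<^sub>2"
proof -
  have "v\<^sub>2 f \<sqsubset> v\<^sub>1 f" if "f \<in> V - {0}" "\<not> v\<^sub>1 f \<sqsubset> v\<^sub>2 f" for f
    using disjoint_values[OF that(1) that(1)] that(2) le_total by (auto simp: lt_def)
  moreover have "\<not> v\<^sub>1 f \<sqsubset> v\<^sub>2 f" if "v\<^sub>2 f \<sqsubset> v\<^sub>1 f" for f
    using that by (rule og.less_not_sym)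
  ultimately show ?thesis
    unfolding vmax_def dominant\<^sub>1_def dominant\<^sub>2_def
    by (auto simp: image_iff split: if_splits)
qed

lemma dominant_disjoint: "dominant\<^sub>1 \<inter> dominant\<^sub>2 = {}"
  using disjoint_values by (fastforce simp: dominant\<^sub>1_def dominant\<^sub>2_def)

lemma subspace_vmax_less: "subspace {f. f = 0 \<or> vmax f \<sqsubset> x}"
proof -
  have "{f. f = 0 \<or> vmax f \<sqsubset> x} = {f. f = 0 \<or> v\<^sub>1 f \<sqsubset> x} \<inter> {f. f = 0 \<or> v\<^sub>2 f \<sqsubset> x}"
    unfolding vmax_def by (auto intro: og.less_trans og.le_less_trans simp: og.not_less)
  then show ?thesis
    using subspace_inter[OF subspace_valuation_less[OF val1] subspace_valuation_less[OF val2]]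
    by simp
qed

text \<open>The subspace on which the dimension count is carried out: the bound on both values is a
  bound on \<open>vmax\<close>.\<close>

definition Vle :: "nat \<Rightarrow> 'a set"
  where "Vle n = {f \<in> V. f = 0 \<or> v\<^sub>1 f \<sqsubseteq> nat_mult n \<delta> \<and> v\<^sub>2 f \<sqsubseteq> nat_mult n \<delta>}"

lemma subspace_Vle: "subspace (Vle n)"
proof -
  have "Vle n = V \<inter> ({f. f = 0 \<or> v\<^sub>1 f \<sqsubseteq> nat_mult n \<delta>} \<inter> {f. f = 0 \<or> v\<^sub>2 f \<sqsubseteq> nat_mult n \<delta>})"
    unfolding Vle_def by auto
  then show ?thesis
    using subspace_inter[OF subspace_V subspace_inter[OF subspace_valuation_le[OF val1]
          subspace_valuation_le[OF val2]]]
    by simp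
qed

lemma vmax_Vle: "vmax ` (Vle n - {0}) = bounded (dominant\<^sub>1 \<union> dominant\<^sub>2) n"
proof -
  have "Vle n - {0} = {f \<in> V - {0}. vmax f \<sqsubseteq> nat_mult n \<delta>}"
    unfolding Vle_def vmax_def by (auto intro: le_trans simp: og.not_less lt_def)
  then show ?thesis
    unfolding bounded_def vmax_image[symmetric] by auto
qed

text \<open>By \<open>cover1\<close> a value is a base point plus a sum over T. A sum of s terms is
  at least s times \<open>\<delta>\<close>, so values up to n times \<open>\<delta>\<close> use at
  most n terms.\<close>

lemma bounded_values1:
  "finite (bounded (v\<^sub>1 ` (V - {0})) n) \<and>
    card (bounded (v\<^sub>1 ` (V - {0})) n) \<le> card F\<^sub>1 * (n + 1) ^ card T"
proof -
  let ?M = "{M. set_mset M \<subseteq> T \<and> size M \<le> n}"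
  let ?f = "\<lambda>(g, M). v\<^sub>1 g + sum_mset M"
  have fin: "finite (F\<^sub>1 \<times> ?M)"
    using F1 finite_T card_bounded_multisets by blast
  have sub: "bounded (v\<^sub>1 ` (V - {0})) n \<subseteq> ?f ` (F\<^sub>1 \<times> ?M)"
  proof
    fix x assume "x \<in> bounded (v\<^sub>1 ` (V - {0})) n"
    then obtain f where f: "f \<in> V - {0}" "x = v\<^sub>1 f" "x \<sqsubseteq> nat_mult n \<delta>"
      by (auto simp: bounded_def)
    obtain g M where g: "g \<in> F\<^sub>1" "set_mset M \<subseteq> T" "v\<^sub>1 f = v\<^sub>1 g + sum_mset M"
      using cover1[OF f(1)] by blast
    have "nat_mult (size M) \<delta> \<sqsubseteq> sum_mset M"
      using g(2) T_ge by (intro sum_mset_lower_bound) auto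
    also have "sum_mset M \<sqsubset> v\<^sub>1 g + sum_mset M"
      using pos1 g(1) F1(2) by auto
    also have "v\<^sub>1 g + sum_mset M \<sqsubseteq> nat_mult n \<delta>"
      using f g by simp
    finally have "size M \<le> n"
      using \<delta>_pos by (intro nat_mult_le_imp_le[of \<delta>]) (auto simp: lt_def)
    then show "x \<in> ?f ` (F\<^sub>1 \<times> ?M)"
      using f g by force
  qed
  have "card (bounded (v\<^sub>1 ` (V - {0})) n) \<le> card (F\<^sub>1 \<times> ?M)"
    using sub fin surj_card_le by blast
  also have "\<dots> \<le> card F\<^sub>1 * (n + 1) ^ card T"
    using card_bounded_multisets(2)[OF finite_T] by (simp add: card_cartesian_product)
  finally show ?thesis
    using sub fin finite_surj by blast
qed

text \<open>On \<open>Vle n\<close> the function \<open>vmax\<close> has at most as many values as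
  the dimension, and \<open>v\<^sub>1\<close> has exactly that many.\<close>

lemma bounded_dominant_le_values1:
  "card (bounded (dominant\<^sub>1 \<union> dominant\<^sub>2) n) \<le> card (bounded (v\<^sub>1 ` (V - {0})) n)"
proof -
  interpret sw: valuation_pair le sc V T \<delta> v\<^sub>2 v\<^sub>1 F\<^sub>2 F\<^sub>1 by (rule swap)
  have fin: "finite (bounded (v\<^sub>1 ` (V - {0})) n)" "finite (bounded (v\<^sub>2 ` (V - {0})) n)"
    using bounded_values1 sw.bounded_values1 unfolding bounded_def sw.bounded_def by blast+
  have "bounded (dominant\<^sub>1 \<union> dominant\<^sub>2) n \<subseteq>
      bounded (v\<^sub>1 ` (V - {0})) n \<union> bounded (v\<^sub>2 ` (V - {0})) n"
    unfolding bounded_def dominant\<^sub>1_def dominant\<^sub>2_def by auto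
  with fin have fin_u: "finite (vmax ` (Vle n - {0}))"
    unfolding vmax_Vle by (meson finite_UnI finite_subset)
  have sub: "v\<^sub>1 ` (Vle n - {0}) \<subseteq> bounded (v\<^sub>1 ` (V - {0})) n"
    unfolding Vle_def bounded_def by auto
  have "card (vmax ` (Vle n - {0})) \<le> card (v\<^sub>1 ` (Vle n - {0}))"
    using fin sub by (intro card_values_le subspace_vmax_less fin_u val1 subspace_Vle)
      (auto intro: finite_subset)
  also have "\<dots> \<le> card (bounded (v\<^sub>1 ` (V - {0})) n)"
    by (rule card_mono[OF fin(1) sub])
  finally show ?thesis unfolding vmax_Vle .
qed

lemma finite_bounded_dominant: "finite (bounded dominant\<^sub>1 n)"
proof (rule finite_subset)
  show "bounded dominant\<^sub>1 n \<subseteq> bounded (v\<^sub>1 ` (V - {0})) n"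
    unfolding bounded_def dominant\<^sub>1_def by auto
qed (use bounded_values1 in blast)

text \<open>Take g in \<open>F\<^sub>1\<close> of largest value. The value of g * g is larger than
  every base point, so its decomposition has a nonempty M, and \<open>cover1\<close> then supplies a
  dominant element.\<close>

lemma dominant1_nonempty: "\<exists>h\<in>V - {0}. v\<^sub>2 h \<sqsubset> v\<^sub>1 h"
proof -
  obtain f where "f \<in> V - {0}"
    using nonzero_V subspace_0[OF subspace_V] by blast
  then have "F\<^sub>1 \<noteq> {}" using cover1 by blast
  then obtain g where g: "g \<in> F\<^sub>1" "\<And>g'. g' \<in> F\<^sub>1 \<Longrightarrow> v\<^sub>1 g' \<sqsubseteq> v\<^sub>1 g"
    using finite_has_max[of "v\<^sub>1 ` F\<^sub>1"] F1 by auto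
  then have gV: "g \<in> V - {0}" using F1 by blast
  then have "g * g \<in> V - {0}" using mult_V by auto
  then obtain g' M where M: "g' \<in> F\<^sub>1" "v\<^sub>1 (g * g) = v\<^sub>1 g' + sum_mset M"
      "M = {#} \<or> (\<exists>h\<in>V - {0}. v\<^sub>1 h = sum_mset M \<and> v\<^sub>2 h \<sqsubset> v\<^sub>1 h)"
    using cover1 by blast
  have "v\<^sub>1 g \<sqsubset> v\<^sub>1 (g * g)"
    using gV pos1[OF gV] by (simp add: valuation_mult[OF val1])
  then have "M \<noteq> {#}"
    using M(2) g(2)[OF M(1)] og.leD by auto
  with M(3) show ?thesis by blast
qed

text \<open>Replacing the base point \<open>g\<close> of each value by a fixed dominant element costs a factor
  of at most \<open>card F\<^sub>1\<close>.\<close>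

lemma values_le_dominant1:
  "\<exists>p. \<forall>m\<ge>p. \<forall>n. card (bounded (v\<^sub>1 ` (V - {0})) n) \<le> card F\<^sub>1 * card (bounded dominant\<^sub>1 (n + m))"
proof -
  obtain k where k: "k \<in> V - {0}" "v\<^sub>2 k \<sqsubset> v\<^sub>1 k"
    using dominant1_nonempty by blast
  obtain p where p: "v\<^sub>1 k \<sqsubseteq> nat_mult p \<delta>"
    using archimedean[OF k(1)] by blast
  show ?thesis
  proof (intro exI[of _ p] allI impI)
    fix m n assume "p \<le> m"
    then have m: "v\<^sub>1 k \<sqsubseteq> nat_mult m \<delta>"
      using p nat_mult_mono \<delta>_pos by (meson le_trans lt_def)
    \<comment> \<open>A value is recovered from its base point g and the dominant value
      \<open>sum_mset M + v\<^sub>1 k\<close>, which costs the factor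
      \<open>card F\<^sub>1\<close>.\<close>
    let ?f = "\<lambda>(g, y). v\<^sub>1 g + y - v\<^sub>1 k"
    have "bounded (v\<^sub>1 ` (V - {0})) n \<subseteq> ?f ` (F\<^sub>1 \<times> bounded dominant\<^sub>1 (n + m))"
    proof
      fix x assume "x \<in> bounded (v\<^sub>1 ` (V - {0})) n"
      then obtain f where f: "f \<in> V - {0}" "x = v\<^sub>1 f" "x \<sqsubseteq> nat_mult n \<delta>"
        by (auto simp: bounded_def)
      obtain g M where g: "g \<in> F\<^sub>1" "v\<^sub>1 f = v\<^sub>1 g + sum_mset M"
          "M = {#} \<or> (\<exists>h\<in>V - {0}. v\<^sub>1 h = sum_mset M \<and> v\<^sub>2 h \<sqsubset> v\<^sub>1 h)"
        using cover1[OF f(1)] by blast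
      \<comment> \<open>The factor k covers the case of empty M, where the sum 0 is not itself known
        to be a dominant value. Otherwise a product of two dominant elements is dominant.\<close>
      have dom: "sum_mset M + v\<^sub>1 k \<in> dominant\<^sub>1"
      proof (cases "M = {#}")
        case True
        then show ?thesis using k by (auto simp: dominant\<^sub>1_def)
      next
        case False
        then obtain h where h: "h \<in> V - {0}" "v\<^sub>1 h = sum_mset M" "v\<^sub>2 h \<sqsubset> v\<^sub>1 h"
          using g(3) by blast
        then have "h * k \<in> V - {0}" "v\<^sub>1 (h * k) = sum_mset M + v\<^sub>1 k" "v\<^sub>2 (h * k) \<sqsubset> v\<^sub>1 (h * k)"
          using k mult_V by (auto simp: valuation_mult[OF val1] valuation_mult[OF val2] 
              intro: og.add_strict_mono)
        then show ?thesis by (auto simp: dominant\<^sub>1_def intro!: exI[of _ "h * k"])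
      qed
      have "0 \<sqsubset> v\<^sub>1 g" using g(1) F1 pos1 by blast
      then have "sum_mset M \<sqsubset> v\<^sub>1 g + sum_mset M" by simp
      also have "v\<^sub>1 g + sum_mset M \<sqsubseteq> nat_mult n \<delta>" using f g by simp
      finally have "sum_mset M + v\<^sub>1 k \<sqsubseteq> nat_mult (n + m) \<delta>"
        using m unfolding nat_mult_add by (intro og.add_mono) (auto simp: lt_def)
      with dom have "sum_mset M + v\<^sub>1 k \<in> bounded dominant\<^sub>1 (n + m)"
        by (simp add: bounded_def)
      moreover have "x = ?f (g, sum_mset M + v\<^sub>1 k)"
        using f g by simp
      ultimately show "x \<in> ?f ` (F\<^sub>1 \<times> bounded dominant\<^sub>1 (n + m))"
        using g(1) by blast
    qed
    moreover have "finite (F\<^sub>1 \<times> bounded dominant\<^sub>1 (n + m))"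
      using F1 finite_bounded_dominant by blast
    ultimately have "card (bounded (v\<^sub>1 ` (V - {0})) n) \<le> card (F\<^sub>1 \<times> bounded dominant\<^sub>1 (n + m))"
      using surj_card_le by blast
    then show "card (bounded (v\<^sub>1 ` (V - {0})) n) \<le> card F\<^sub>1 * card (bounded dominant\<^sub>1 (n + m))"
      by (simp add: card_cartesian_product)
  qed
qed

text \<open>Here no factor is lost, because one element \<open>h\<close> makes all base points dominant at once.\<close>

lemma values_le_dominant1_sharp:
  assumes h: "h \<in> V - {0}" "\<And>g. g \<in> F\<^sub>1 \<Longrightarrow> v\<^sub>2 (h * g) \<sqsubset> v\<^sub>1 (h * g)"
  shows "\<exists>p. \<forall>m\<ge>p. \<forall>n. card (bounded (v\<^sub>1 ` (V - {0})) n) \<le> card (bounded dominant\<^sub>1 (n + m))"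
proof -
  obtain p where p: "v\<^sub>1 h \<sqsubseteq> nat_mult p \<delta>"
    using archimedean[OF h(1)] by blast
  show ?thesis
  proof (intro exI[of _ p] allI impI)
    fix m n assume "p \<le> m"
    then have m: "v\<^sub>1 h \<sqsubseteq> nat_mult m \<delta>"
      using p nat_mult_mono \<delta>_pos by (meson le_trans lt_def)
    \<comment> \<open>Translation by a fixed group element is injective, so no cardinality is
      lost.\<close>
    have "(\<lambda>x. x + v\<^sub>1 h) ` bounded (v\<^sub>1 ` (V - {0})) n \<subseteq> bounded dominant\<^sub>1 (n + m)"
    proof clarify
      fix x assume "x \<in> bounded (v\<^sub>1 ` (V - {0})) n"
      then obtain f where f: "f \<in> V - {0}" "x = v\<^sub>1 f" "x \<sqsubseteq> nat_mult n \<delta>"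
        by (auto simp: bounded_def)
      obtain g M where g: "g \<in> F\<^sub>1" "v\<^sub>1 f = v\<^sub>1 g + sum_mset M"
          "M = {#} \<or> (\<exists>k\<in>V - {0}. v\<^sub>1 k = sum_mset M \<and> v\<^sub>2 k \<sqsubset> v\<^sub>1 k)"
        using cover1[OF f(1)] by blast
      have gV: "g \<in> V - {0}" using g(1) F1 by blast
      then have hg: "h * g \<in> V - {0}" using h mult_V by auto
      have vhg: "v\<^sub>1 (h * g) = v\<^sub>1 h + v\<^sub>1 g"
        using gV h by (simp add: valuation_mult[OF val1])
      have "x + v\<^sub>1 h \<in> dominant\<^sub>1"
      proof (cases "M = {#}")
        case True
        then have "x + v\<^sub>1 h = v\<^sub>1 (h * g)" using f g vhg by (simp add: add.commute)
        then show ?thesis using hg h(2)[OF g(1)] by (auto simp: dominant\<^sub>1_def)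
      next
        case False
        then obtain k where k: "k \<in> V - {0}" "v\<^sub>1 k = sum_mset M" "v\<^sub>2 k \<sqsubset> v\<^sub>1 k"
          using g(3) by blast
        have "h * g * k \<in> V - {0}" using hg k mult_V by auto
        moreover have "v\<^sub>1 (h * g * k) = x + v\<^sub>1 h"
          using f g k hg vhg valuation_mult[OF val1, of "h * g" k] by (simp add: add_ac)
        moreover have "v\<^sub>2 (h * g * k) \<sqsubset> v\<^sub>1 (h * g * k)"
          using k hg h(2)[OF g(1)] valuation_mult[OF val1, of "h * g" k]
            valuation_mult[OF val2, of "h * g" k] by (auto intro: og.add_strict_mono)
        ultimately show ?thesis unfolding dominant\<^sub>1_def by force
      qed
      moreover have "x + v\<^sub>1 h \<sqsubseteq> nat_mult (n + m) \<delta>"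
        using f(3) m unfolding nat_mult_add by (rule og.add_mono)
      ultimately show "x + v\<^sub>1 h \<in> bounded dominant\<^sub>1 (n + m)"
        by (simp add: bounded_def)
    qed
    then show "card (bounded (v\<^sub>1 ` (V - {0})) n) \<le> card (bounded dominant\<^sub>1 (n + m))"
      using finite_bounded_dominant by (intro card_inj_on_le[of "\<lambda>x. x + v\<^sub>1 h"]) auto
  qed
qed

text \<open>The element h gives the lossless comparison for \<open>v\<^sub>1\<close>; for
  \<open>v\<^sub>2\<close> the comparison with loss \<open>card F\<^sub>2\<close> is enough.\<close>

lemma contradiction_if_dominating:
  assumes h: "h \<in> V - {0}" "\<And>g. g \<in> F\<^sub>1 \<Longrightarrow> v\<^sub>2 (h * g) \<sqsubset> v\<^sub>1 (h * g)"
  shows False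
proof -
  interpret sw: valuation_pair le sc V T \<delta> v\<^sub>2 v\<^sub>1 F\<^sub>2 F\<^sub>1 by (rule swap)
  have sw_eq: "sw.dominant\<^sub>1 = dominant\<^sub>2" "sw.dominant\<^sub>2 = dominant\<^sub>1"
    by (simp_all add: sw.dominant\<^sub>1_def dominant\<^sub>2_def
        sw.dominant\<^sub>2_def dominant\<^sub>1_def)
  let ?a = "\<lambda>n. card (bounded (dominant\<^sub>1 \<union> dominant\<^sub>2) n)"
  obtain p1 where p1: "\<And>m n. m \<ge> p1 \<Longrightarrow>
      card (bounded (v\<^sub>1 ` (V - {0})) n) \<le> card (bounded dominant\<^sub>1 (n + m))"
    using values_le_dominant1_sharp[OF h] by blast
  obtain p2 where p2: "\<And>m n. m \<ge> p2 \<Longrightarrow>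
      card (bounded (v\<^sub>2 ` (V - {0})) n) \<le> card F\<^sub>2 * card (bounded dominant\<^sub>2 (n + m))"
    using sw.values_le_dominant1[unfolded sw_eq] by blast
  define p where "p = max p1 p2"
  have split: "?a n = card (bounded dominant\<^sub>1 n) + card (bounded dominant\<^sub>2 n)" for n
  proof -
    have "bounded (dominant\<^sub>1 \<union> dominant\<^sub>2) n = bounded dominant\<^sub>1 n \<union> bounded dominant\<^sub>2 n"
      by (auto simp: bounded_def)
    moreover have "bounded dominant\<^sub>1 n \<inter> bounded dominant\<^sub>2 n = {}"
      using dominant_disjoint by (auto simp: bounded_def)
    ultimately show ?thesis
      using finite_bounded_dominant sw.finite_bounded_dominant[unfolded sw_eq] by (simp add: card_Un_disjoint)
  qed
  \<comment> \<open>With c = \<open>card F\<^sub>2\<close>, add c times the estimate by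
    first-dominant values to the estimate by second-dominant values. The two kinds are disjoint and
    together make up \<open>?a (n + p)\<close>.\<close>
  have growth: "(card F\<^sub>2 + 1) * ?a n \<le> card F\<^sub>2 * ?a (n + p)" for n
  proof -
    have "?a n \<le> card (bounded dominant\<^sub>1 (n + p))"
      using bounded_dominant_le_values1[of n] p1[of p n] by (simp add: p_def)
    then have "card F\<^sub>2 * ?a n \<le> card F\<^sub>2 * card (bounded dominant\<^sub>1 (n + p))"
      by (rule mult_le_mono2)
    moreover have "?a n \<le> card F\<^sub>2 * card (bounded dominant\<^sub>2 (n + p))"
      using sw.bounded_dominant_le_values1[unfolded sw_eq, of n] p2[of p n] by (simp add: p_def Un_commute)
    ultimately have "card F\<^sub>2 * ?a n + ?a n \<le>
        card F\<^sub>2 * card (bounded dominant\<^sub>1 (n + p)) + card F\<^sub>2 * card (bounded dominant\<^sub>2 (n + p))"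
      by (rule add_mono)
    then show ?thesis
      unfolding split[of "n + p"] by (simp only: distrib_left distrib_right mult_1)
  qed
  have bound: "?a n \<le> card F\<^sub>1 * (n + 1) ^ card T" for n
    using bounded_dominant_le_values1[of n] bounded_values1[of n] by linarith
  obtain k where k: "k \<in> V - {0}" "v\<^sub>2 k \<sqsubset> v\<^sub>1 k"
    using dominant1_nonempty by blast
  obtain q where "v\<^sub>1 k \<sqsubseteq> nat_mult q \<delta>"
    using archimedean[OF k(1)] by blast
  with k have "v\<^sub>1 k \<in> bounded dominant\<^sub>1 q"
    by (auto simp: bounded_def dominant\<^sub>1_def)
  then have "?a q \<ge> 1"
    unfolding split using finite_bounded_dominant[of q] card_gt_0_iff[of "bounded dominant\<^sub>1 q"]
    by fastforce
  from no_geometric_growth_of_poly_bounded[OF growth this bound] show False .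
qed

text \<open>One factor f compensates the deficit of any base point g, up to a possible tie. A second
  factor f breaks the tie, because its own advantage is strictly positive by
  \<open>disjoint_values\<close>. Hence f * f dominates as required.\<close>

lemma contradiction_if_max:
  assumes f: "f \<in> V - {0}" and "0 \<sqsubseteq> v\<^sub>1 f - v\<^sub>2 f"
    and max: "\<And>g. g \<in> F\<^sub>1 \<Longrightarrow> v\<^sub>2 g - v\<^sub>1 g \<sqsubseteq> v\<^sub>1 f - v\<^sub>2 f"
  shows False
proof (rule contradiction_if_dominating)
  have pos: "v\<^sub>2 f \<sqsubset> v\<^sub>1 f"
    using assms(2) disjoint_values[OF f f] by (auto simp: lt_def)
  show "f * f \<in> V - {0}" using f mult_V by auto
  fix g assume g: "g \<in> F\<^sub>1"
  then have "g \<noteq> 0" using F1 by auto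
  have "v\<^sub>2 g + v\<^sub>2 f \<sqsubseteq> v\<^sub>1 f + v\<^sub>1 g"
    using og.add_right_mono[OF max[OF g], of "v\<^sub>1 g + v\<^sub>2 f"] by (simp add: algebra_simps)
  then have "(v\<^sub>2 g + v\<^sub>2 f) + v\<^sub>2 f \<sqsubset> (v\<^sub>1 f + v\<^sub>1 g) + v\<^sub>1 f"
    using pos by (rule og.add_le_less_mono)
  then show "v\<^sub>2 (f * f * g) \<sqsubset> v\<^sub>1 (f * f * g)"
    using f \<open>g \<noteq> 0\<close> by (simp add: valuation_mult[OF val1] valuation_mult[OF val2] algebra_simps)
qed

theorem inconsistent: False
proof -
  interpret sw: valuation_pair le sc V T \<delta> v\<^sub>2 v\<^sub>1 F\<^sub>2 F\<^sub>1 by (rule swap)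
  let ?d = "\<lambda>f. v\<^sub>1 f - v\<^sub>2 f"
  \<comment> \<open>Both signs are included, so the maximum of this set is the largest absolute
    difference of the two values over all base points. Its sign decides which valuation plays the
    dominating role.\<close>
  let ?A = "?d ` (F\<^sub>1 \<union> F\<^sub>2) \<union> (\<lambda>f. - ?d f) ` (F\<^sub>1 \<union> F\<^sub>2)"
  obtain f where "f \<in> V - {0}"
    using nonzero_V subspace_0[OF subspace_V] by blast
  then have "?A \<noteq> {}" using cover1 by blast
  moreover have "finite ?A" using F1 F2 by blast
  ultimately obtain m where m: "m \<in> ?A" "\<And>a. a \<in> ?A \<Longrightarrow> a \<sqsubseteq> m"
    using finite_has_max by meson
  from m(1) obtain f where f: "f \<in> F\<^sub>1 \<union> F\<^sub>2" "m = ?d f \<or> m = - ?d f" by auto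
  then have fV: "f \<in> V - {0}" using F1 F2 by blast
  have le: "?d g \<sqsubseteq> m" "- ?d g \<sqsubseteq> m" if "g \<in> F\<^sub>1 \<union> F\<^sub>2" for g
    using that by (auto intro!: m(2))
  have "0 \<sqsubseteq> m"
    using le[OF f(1)] le_total[of 0 "?d f"] le_trans og.neg_0_le_iff_le by blast
  from f(2) show False
  proof
    assume "m = ?d f"
    then show False using contradiction_if_max[OF fV] \<open>0 \<sqsubseteq> m\<close> le by auto
  next
    assume "m = - ?d f"
    then show False using sw.contradiction_if_max[OF fV] \<open>0 \<sqsubseteq> m\<close> le by auto
  qed
qed

end

section \<open>Degrees of Laurent polynomials\<close>

lemma lookup_lscale: "Poly_Mapping.lookup (lscale c f) x = c * Poly_Mapping.lookup f x"
  by (simp add: lscale_def Poly_Mapping.map.rep_eq when_def)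

lemma keys_lscale_subset: "Poly_Mapping.keys (lscale c f) \<subseteq> Poly_Mapping.keys f"
  by (auto simp: in_keys_iff lookup_lscale)

lemma real_vec_add: "real_vec (a + b) = real_vec a + real_vec b"
  by (simp add: real_vec_def vec_eq_iff)

lemma real_vec_zero [simp]: "real_vec 0 = 0"
  by (simp add: real_vec_def vec_eq_iff)

text \<open>The hull is an intersection of ideals of B. Since B is itself one of them, the
  intersection stays inside B.\<close>

lemma ideal_of_generated_ideal:
  assumes "ideal_of B B" "X \<subseteq> B"
  shows "ideal_of B (generated_ideal B X)"
proof -
  have "generated_ideal B X \<subseteq> B"
    unfolding generated_ideal_def using assms by (intro hull_minimal)
  then show ?thesis
    unfolding ideal_of_def by (auto simp: generated_ideal_def hull_def ideal_of_def)
qed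

lemma ideal_of_subalgebra_self:
  fixes B :: "('n::finite, 'k::field) laurent set"
  assumes B: "subalgebra lscale B"
  shows "ideal_of B B"
proof -
  \<comment> \<open>\<open>subalgebra\<close> does not list 0 among its closure conditions; it
    arises as a scalar multiple of 1.\<close>
  have "lscale 0 1 \<in> B" using B by (auto simp: subalgebra_def)
  moreover have "lscale 0 1 = (0 :: ('n, 'k) laurent)"
    by (rule poly_mapping_eqI) (simp add: lookup_lscale)
  ultimately have "0 \<in> B" by simp
  with B show ?thesis by (auto simp: subalgebra_def ideal_of_def)
qed

lemma Omega_ordered_group:
  assumes "le \<in> Omega"
  shows "ordered_group le"
proof
  show "le x y \<or> le y x" for x y
    using assms unfolding Omega_def by (cases "x = y") (auto dest: reflpD totalpD)
qed (use assms in \<open>auto simp: Omega_def dest: reflpD antisympD transpD\<close>)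

locale laurent_order = ordered_group le
  for le :: "int ^ 'n::finite \<Rightarrow> int ^ 'n \<Rightarrow> bool" (infix "\<sqsubseteq>" 50)
begin

lemma deg_eqI:
  assumes "a \<in> Poly_Mapping.keys f" "\<And>b. b \<in> Poly_Mapping.keys f \<Longrightarrow> b \<sqsubseteq> a"
  shows "deg le f = a"
  unfolding deg_def is_max_def using assms le_antisym by (intro the_equality) blast+

lemma deg_in_keys: "f \<noteq> 0 \<Longrightarrow> deg le f \<in> Poly_Mapping.keys f"
  and keys_le_deg: "f \<noteq> 0 \<Longrightarrow> b \<in> Poly_Mapping.keys f \<Longrightarrow> b \<sqsubseteq> deg le f"
proof -
  have "deg le f \<in> Poly_Mapping.keys f \<and> (\<forall>b \<in> Poly_Mapping.keys f. b \<sqsubseteq> deg le f)" if "f \<noteq> 0"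
  proof -
    have "Poly_Mapping.keys f \<noteq> {}" using that by simp
    then obtain m where "m \<in> Poly_Mapping.keys f" "\<forall>a \<in> Poly_Mapping.keys f. a \<sqsubseteq> m"
      using finite_has_max[OF finite_keys] by blast
    then show ?thesis using deg_eqI by blast
  qed
  then show "f \<noteq> 0 \<Longrightarrow> deg le f \<in> Poly_Mapping.keys f"
    and "f \<noteq> 0 \<Longrightarrow> b \<in> Poly_Mapping.keys f \<Longrightarrow> b \<sqsubseteq> deg le f" by blast+
qed

text \<open>Split off the leading terms. All remaining products have exponents strictly below
  \<open>?a + ?b\<close>, so the coefficient there is \<open>?c * ?d\<close>, a product of nonzero
  scalars.\<close>

lemma deg_mult:
  fixes f g :: "('n, 'k::field) laurent"
  assumes "f \<noteq> 0" "g \<noteq> 0"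
  shows "deg le (f * g) = deg le f + deg le g" and "f * g \<noteq> 0"
proof -
  let ?a = "deg le f" and ?b = "deg le g"
  let ?c = "Poly_Mapping.lookup f ?a" and ?d = "Poly_Mapping.lookup g ?b"
  define f' where "f' = f - Poly_Mapping.single ?a ?c"
  define g' where "g' = g - Poly_Mapping.single ?b ?d"
  have f': "x \<sqsubset> ?a" if "x \<in> Poly_Mapping.keys f'" for x
  proof -
    have "x \<noteq> ?a" "x \<in> Poly_Mapping.keys f"
      using that unfolding f'_def by (auto simp: in_keys_iff lookup_minus lookup_single when_def split: if_splits)
    then show ?thesis using keys_le_deg[OF assms(1)] by (simp add: lt_def)
  qed
  have g': "x \<sqsubset> ?b" if "x \<in> Poly_Mapping.keys g'" for x
  proof -
    have "x \<noteq> ?b" "x \<in> Poly_Mapping.keys g"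
      using that unfolding g'_def by (auto simp: in_keys_iff lookup_minus lookup_single when_def split: if_splits)
    then show ?thesis using keys_le_deg[OF assms(2)] by (simp add: lt_def)
  qed
  have "Poly_Mapping.single ?a ?c * g + f' * g =
      Poly_Mapping.single (?a + ?b) (?c * ?d) + Poly_Mapping.single ?a ?c * g' + f' * g"
    by (simp add: g'_def algebra_simps mult_single)
  moreover have "f * g = Poly_Mapping.single ?a ?c * g + f' * g"
    by (simp add: f'_def algebra_simps)
  ultimately have fg: "f * g =
      Poly_Mapping.single (?a + ?b) (?c * ?d) + Poly_Mapping.single ?a ?c * g' + f' * g" by simp
  have "?a + ?b \<notin> Poly_Mapping.keys (Poly_Mapping.single ?a ?c * g')"
    using keys_mult[of "Poly_Mapping.single ?a ?c" g'] g' by (fastforce split: if_splits simp: lt_def)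
  moreover have "?a + ?b \<notin> Poly_Mapping.keys (f' * g)"
  proof
    assume "?a + ?b \<in> Poly_Mapping.keys (f' * g)"
    then obtain x y where "x \<in> Poly_Mapping.keys f'" "y \<in> Poly_Mapping.keys g" "?a + ?b = x + y"
      using keys_mult[of f' g] by blast
    then have "?a + ?b \<sqsubset> ?a + ?b"
      using f' keys_le_deg[OF assms(2)] og.add_less_le_mono[of x ?a y ?b] by simp
    then show False by simp
  qed
  ultimately have "Poly_Mapping.lookup (f * g) (?a + ?b) = ?c * ?d"
    unfolding fg lookup_add by (simp add: in_keys_iff)
  moreover have "?c \<noteq> 0" "?d \<noteq> 0"
    using deg_in_keys[OF assms(1)] deg_in_keys[OF assms(2)] by (simp_all add: in_keys_iff)
  ultimately have mem: "?a + ?b \<in> Poly_Mapping.keys (f * g)"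
    by (simp add: in_keys_iff)
  then show "f * g \<noteq> 0" by auto
  show "deg le (f * g) = ?a + ?b"
  proof (rule deg_eqI[OF mem])
    fix z assume "z \<in> Poly_Mapping.keys (f * g)"
    then obtain x y where "x \<in> Poly_Mapping.keys f" "y \<in> Poly_Mapping.keys g" "z = x + y"
      using keys_mult[of f g] by blast
    then show "z \<sqsubseteq> ?a + ?b"
      using keys_le_deg[OF assms(1)] keys_le_deg[OF assms(2)] by (simp add: og.add_mono)
  qed
qed

lemma valuation_deg:
  fixes sc :: "'k::field \<Rightarrow> 'r::idom \<Rightarrow> 'r" and \<psi> :: "'r \<Rightarrow> ('n, 'k) laurent"
  assumes "k_algebra_hom sc lscale \<psi>" "inj \<psi>"
  shows "valued_algebra.valuation le sc (\<lambda>f. deg le (\<psi> f))"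
proof -
  interpret h: k_algebra_hom sc lscale \<psi> by fact
  interpret valued_algebra le sc by unfold_locales
  have nz: "\<psi> f \<noteq> 0" if "f \<noteq> 0" for f
    using that assms(2) h.zero by (metis injD)
  show ?thesis
    unfolding valuation_def
  proof (intro conjI allI impI)
    fix f g :: 'r assume fg: "f \<noteq> 0" "g \<noteq> 0"
    show "deg le (\<psi> (f * g)) = deg le (\<psi> f) + deg le (\<psi> g)"
      using fg nz by (simp add: h.hom_mult deg_mult)
    show "deg le (\<psi> (f + g)) \<sqsubseteq> deg le (\<psi> f) \<or> deg le (\<psi> (f + g)) \<sqsubseteq> deg le (\<psi> g)"
      if "f + g \<noteq> 0"
      using deg_in_keys[OF nz[OF that]] keys_le_deg[OF nz[OF fg(1)]] keys_le_deg[OF nz[OF fg(2)]]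
        keys_add[of "\<psi> f" "\<psi> g"] by (auto simp: h.add)
    let ?x = "deg le (\<psi> f)"
    assume eq: "deg le (\<psi> f) = deg le (\<psi> g)"
    \<comment> \<open>The quotient of the leading coefficients: subtracting c times g cancels the
      leading term of the image of f.\<close>
    define c where "c = Poly_Mapping.lookup (\<psi> f) ?x / Poly_Mapping.lookup (\<psi> g) ?x"
    have gx: "Poly_Mapping.lookup (\<psi> g) ?x \<noteq> 0"
      using deg_in_keys[OF nz[OF fg(2)]] eq by (simp add: in_keys_iff)
    have lookup: "Poly_Mapping.lookup (\<psi> (f - sc c g)) z =
        Poly_Mapping.lookup (\<psi> f) z - c * Poly_Mapping.lookup (\<psi> g) z" for z
      by (simp add: h.diff h.scale lookup_minus lookup_lscale)
    have "deg le (\<psi> (f - sc c g)) \<sqsubset> ?x" if "f \<noteq> sc c g"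
    proof -
      let ?y = "deg le (\<psi> (f - sc c g))"
      have "f - sc c g \<noteq> 0" using that by simp
      then have y: "?y \<in> Poly_Mapping.keys (\<psi> (f - sc c g))"
        by (intro deg_in_keys nz)
      then have "?y \<in> Poly_Mapping.keys (\<psi> f) \<or> ?y \<in> Poly_Mapping.keys (\<psi> g)"
        by (auto simp: in_keys_iff lookup)
      then have "?y \<sqsubseteq> ?x"
        using keys_le_deg[OF nz[OF fg(1)]] keys_le_deg[OF nz[OF fg(2)]] eq by auto
      moreover have "?y \<noteq> ?x"
      proof
        assume "?y = ?x"
        with y have "Poly_Mapping.lookup (\<psi> (f - sc c g)) ?x \<noteq> 0" by (simp add: in_keys_iff)
        then show False unfolding lookup using gx by (simp add: c_def)
      qed
      ultimately show ?thesis by (simp add: lt_def)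
    qed
    then show "\<exists>c. f = sc c g \<or> deg le (\<psi> (f - sc c g)) \<sqsubset> deg le (\<psi> f)" by blast
  next
    fix c :: 'k and f :: 'r assume "c \<noteq> 0" "f \<noteq> 0"
    then have "Poly_Mapping.keys (lscale c (\<psi> f)) = Poly_Mapping.keys (\<psi> f)"
      by (auto simp: in_keys_iff lookup_lscale)
    then show "deg le (\<psi> (sc c f)) = deg le (\<psi> f)"
      by (simp add: h.scale deg_def)
  qed
qed

end

section \<open>The degree monoid of the construction\<close>

locale cone_construction = laurent_order le + k_algebra sc
  for le :: "int ^ 'n::finite \<Rightarrow> int ^ 'n \<Rightarrow> bool" (infix "\<sqsubseteq>" 50)
    and sc :: "'k::field \<Rightarrow> 'r::idom \<Rightarrow> 'r" +
  fixes C :: "(real ^ 'n) set" and Cf :: "nat \<Rightarrow> (real ^ 'n) set" and r :: nat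
    and I :: "'r set" and \<phi> :: "nat \<Rightarrow> 'r \<Rightarrow> ('n, 'k) laurent" and U :: "('n, 'k) laurent set"
    and N :: nat and \<rho> :: "nat \<Rightarrow> 'r"
  assumes cone: "convex_cone C"
    and two_le_r: "2 \<le> r"
    and face: "i \<in> {1..r} \<Longrightarrow> cone_face (Cf i) C"
    and ideal: "ideal_of UNIV I"
    and I_nonzero: "I \<noteq> {0}"
    and hom: "i \<in> {1..r} \<Longrightarrow> k_algebra_hom sc lscale (\<phi> i)"
    and inj: "i \<in> {1..r} \<Longrightarrow> inj (\<phi> i)"
    and supp_phi: "i \<in> {1..r} \<Longrightarrow> real_vec ` supp (\<phi> i ` I) \<subseteq> face_circ r Cf i"
    and supp_U: "real_vec ` supp U \<subseteq> cone_circ r C Cf"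
    and gens: "\<rho> ` {1..N} \<subseteq> I"
begin

sublocale valued_algebra le sc ..

abbreviation "v i f \<equiv> deg le (\<phi> i f)"
abbreviation "B \<equiv> algB r \<phi> I U"
abbreviation "J \<equiv> idealJ r \<phi> I U"
abbreviation "A \<equiv> algA r \<phi> I U N \<rho>"
abbreviation "P \<equiv> phi_sum r \<phi>"
abbreviation "D \<equiv> deg_set le A"

section \<open>Faces of the cone and supports of polynomials\<close>

lemma exists_other_index: "i \<in> {1..r} \<Longrightarrow> \<exists>l\<in>{1..r}. l \<noteq> i"
  using two_le_r by (intro bexI[of _ "if i = 1 then 2 else 1"]) auto

lemma face_subset: "i \<in> {1..r} \<Longrightarrow> Cf i \<subseteq> C"
  using face unfolding cone_face_def by blast

lemma zero_in_cone: "0 \<in> C"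
  using cone by (simp add: convex_cone_iff)

lemma zero_in_face: "i \<in> {1..r} \<Longrightarrow> 0 \<in> Cf i"
  using face[of i] zero_in_cone unfolding cone_face_def by auto

text \<open>A normal vector is nonnegative on C, and two nonnegative numbers have sum 0 only if both
  vanish.\<close>

lemma add_in_face_iff:
  assumes i: "i \<in> {1..r}" and "a \<in> C" "b \<in> C"
  shows "a + b \<in> Cf i \<longleftrightarrow> a \<in> Cf i \<and> b \<in> Cf i"
proof -
  obtain w where w: "Cf i = {a \<in> C. w \<bullet> a = 0}" "\<And>a. a \<in> C \<Longrightarrow> w \<bullet> a \<ge> 0"
    using face[OF i] unfolding cone_face_def by blast
  have "a + b \<in> C" using assms cone convex_cone_add by blast
  then show ?thesis
    using w(2)[OF assms(2)] w(2)[OF assms(3)] assms(2,3)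
    by (auto simp: w(1) inner_add_right add_nonneg_eq_0_iff)
qed

lemma cone_circ_absorbs:
  assumes "a \<in> cone_circ r C Cf" "b \<in> C"
  shows "a + b \<in> cone_circ r C Cf"
  using assms add_in_face_iff convex_cone_add[OF cone] unfolding cone_circ_def by auto

text \<open>If the sum lay in a face \<open>Cf l\<close>, both summands would. The first rules out l
  other than i, the second rules out l = i.\<close>

lemma face_circ_add:
  assumes "i \<in> {1..r}" "j \<in> {1..r}" "i \<noteq> j" "a \<in> face_circ r Cf i" "b \<in> face_circ r Cf j"
  shows "a + b \<in> cone_circ r C Cf"
proof -
  have ab: "a \<in> C" "b \<in> C"
    using assms face_subset unfolding face_circ_def by auto
  have "a + b \<notin> Cf l" if l: "l \<in> {1..r}" for l
    using assms l unfolding add_in_face_iff[OF l ab] face_circ_def by (cases "l = i") auto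
  with ab show ?thesis
    using convex_cone_add[OF cone] by (auto simp: cone_circ_def)
qed

definition supported :: "(real ^ 'n) set \<Rightarrow> ('n, 'k) laurent set"
  where "supported X = {f. real_vec ` Poly_Mapping.keys f \<subseteq> X}"

lemma supported_zero [simp]: "0 \<in> supported X"
  by (simp add: supported_def)

lemma supported_add: "f \<in> supported X \<Longrightarrow> g \<in> supported X \<Longrightarrow> f + g \<in> supported X"
  using keys_add[of f g] unfolding supported_def by blast

lemma supported_mult:
  assumes "f \<in> supported X" "g \<in> supported Y" "\<And>a b. a \<in> X \<Longrightarrow> b \<in> Y \<Longrightarrow> a + b \<in> Z"
  shows "f * g \<in> supported Z"
proof -
  have "real_vec c \<in> Z" if "c \<in> Poly_Mapping.keys (f * g)" for c
  proof -
    obtain a b where "c = a + b" "a \<in> Poly_Mapping.keys f" "b \<in> Poly_Mapping.keys g"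
      using \<open>c \<in> Poly_Mapping.keys (f * g)\<close> keys_mult[of f g] by blast
    then show ?thesis
      using assms by (auto simp: supported_def real_vec_add)
  qed
  then show ?thesis by (auto simp: supported_def)
qed

lemma phi_supported: "i \<in> {1..r} \<Longrightarrow> f \<in> I \<Longrightarrow> \<phi> i f \<in> supported (face_circ r Cf i)"
  using supp_phi[of i] unfolding supp_def supported_def by (cases "\<phi> i f = 0") auto

lemma U_supported: "u \<in> U \<Longrightarrow> u \<in> supported (cone_circ r C Cf)"
  using supp_U unfolding supp_def supported_def by (cases "u = 0") auto

text \<open>The origin lies in every face and there are at least two faces, so it is not in
  \<open>face_circ r Cf i\<close>.\<close>

lemma zero_notin_keys_phi:
  assumes "i \<in> {1..r}" "f \<in> I"
  shows "0 \<notin> Poly_Mapping.keys (\<phi> i f)"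
proof
  assume "0 \<in> Poly_Mapping.keys (\<phi> i f)"
  then have "real_vec 0 \<in> face_circ r Cf i"
    using phi_supported[OF assms] unfolding supported_def by blast
  moreover obtain l where "l \<in> {1..r}" "l \<noteq> i"
    using exists_other_index[OF assms(1)] by blast
  ultimately show False
    using zero_in_face[of l] unfolding face_circ_def by auto
qed

lemma face_circ_subset: "i \<in> {1..r} \<Longrightarrow> face_circ r Cf i \<subseteq> C"
  using face_subset unfolding face_circ_def by blast

lemma supported_mono: "f \<in> supported X \<Longrightarrow> X \<subseteq> Y \<Longrightarrow> f \<in> supported Y"
  unfolding supported_def by blast

section \<open>The algebra B and its ideal J\<close>

lemma subalgebra_B: "subalgebra lscale B"
  unfolding algB_def by (rule subalgebra_generated_subalgebra)

lemma B_closed: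
  "1 \<in> B" "f \<in> B \<Longrightarrow> g \<in> B \<Longrightarrow> f + g \<in> B" "f \<in> B \<Longrightarrow> g \<in> B \<Longrightarrow> f * g \<in> B"
  "f \<in> B \<Longrightarrow> lscale c f \<in> B"
  using subalgebra_B unfolding subalgebra_def by blast+

lemma zero_in_B: "0 \<in> B"
  using ideal_of_subalgebra_self[OF subalgebra_B] unfolding ideal_of_def by blast

lemma phi_in_B: "i \<in> {1..r} \<Longrightarrow> f \<in> I \<Longrightarrow> \<phi> i f \<in> B"
  unfolding algB_def generated_subalgebra_def by (rule hull_inc) blast

lemma U_subset_B: "U \<subseteq> B"
  unfolding algB_def generated_subalgebra_def by (blast intro: hull_inc)

lemma B_supported: "B \<subseteq> supported C"
  unfolding algB_def generated_subalgebra_def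
proof (rule hull_minimal)
  have "\<phi> i f \<in> supported C" if "i \<in> {1..r}" "f \<in> I" for i f
    using phi_supported[OF that] face_circ_subset[OF that(1)] by (rule supported_mono)
  moreover have "u \<in> supported C" if "u \<in> U" for u
    using U_supported[OF that] by (rule supported_mono) (auto simp: cone_circ_def)
  ultimately show "(\<Union>i\<in>{1..r}. \<phi> i ` I) \<union> U \<subseteq> supported C" by blast
  have "1 \<in> supported C"
    using zero_in_cone by (simp add: supported_def)
  moreover have "f * g \<in> supported C" if "f \<in> supported C" "g \<in> supported C" for f g
    using that by (rule supported_mult) (rule convex_cone_add[OF cone])
  moreover have "lscale c f \<in> supported C" if "f \<in> supported C" for c f
    using that keys_lscale_subset[of c f] unfolding supported_def by blast
  ultimately show "subalgebra lscale (supported C)"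
    unfolding subalgebra_def using supported_add by blast
qed

lemma J_generators_subset_B:
  "{\<phi> i x * \<phi> j y | i j x y. 1 \<le> i \<and> i < j \<and> j \<le> r \<and> x \<in> I \<and> y \<in> I} \<union> U \<subseteq> B"
  using U_subset_B by (auto intro!: B_closed phi_in_B)

lemma ideal_J: "ideal_of B J"
  unfolding idealJ_def
  by (rule ideal_of_generated_ideal[OF ideal_of_subalgebra_self[OF subalgebra_B] J_generators_subset_B])

lemma J_closed:
  "0 \<in> J" "f \<in> J \<Longrightarrow> g \<in> J \<Longrightarrow> f + g \<in> J" "b \<in> B \<Longrightarrow> f \<in> J \<Longrightarrow> b * f \<in> J"
  using ideal_J unfolding ideal_of_def by blast+

lemma J_subset_B: "J \<subseteq> B"
  using ideal_J unfolding ideal_of_def by blast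

text \<open>The members of B supported off all the faces form an ideal of B, since adding a point of
  C never returns to a face. This ideal contains the generators of J.\<close>

lemma J_supported: "J \<subseteq> supported (cone_circ r C Cf)"
proof -
  let ?K = "{f \<in> B. f \<in> supported (cone_circ r C Cf)}"
  have "J \<subseteq> ?K"
    unfolding idealJ_def generated_ideal_def
  proof (rule hull_minimal)
    have "\<phi> i x * \<phi> j y \<in> supported (cone_circ r C Cf)"
      if "1 \<le> i" "i < j" "j \<le> r" "x \<in> I" "y \<in> I" for i j x y
      using that by (intro supported_mult[OF phi_supported phi_supported] face_circ_add[of i j]) auto
    then show "{\<phi> i x * \<phi> j y | i j x y. 1 \<le> i \<and> i < j \<and> j \<le> r \<and> x \<in> I \<and> y \<in> I} \<union> U \<subseteq> ?K"
      using J_generators_subset_B U_supported by blast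
    have "b * x \<in> supported (cone_circ r C Cf)"
      if "b \<in> B" "x \<in> supported (cone_circ r C Cf)" for b x
    proof -
      have "x * b \<in> supported (cone_circ r C Cf)"
        using that B_supported by (intro supported_mult[OF that(2), of b C] cone_circ_absorbs) auto
      then show ?thesis by (simp add: mult.commute)
    qed
    then show "ideal_of B ?K"
      unfolding ideal_of_def using B_closed zero_in_B supported_add by auto
  qed
  then show ?thesis by blast
qed

lemma phi_product_in_J:
  assumes "i \<in> {1..r}" "j \<in> {1..r}" "i \<noteq> j" "x \<in> I" "y \<in> I"
  shows "\<phi> i x * \<phi> j y \<in> J"
proof -
  have "\<phi> i x * \<phi> j y \<in> J" if "1 \<le> i" "i < j" "j \<le> r" "x \<in> I" "y \<in> I" for i j x y
    unfolding idealJ_def generated_ideal_def using that by (intro hull_inc) blast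
  from this[of i j x y] this[of j i y x] show ?thesis
    using assms by (cases "i < j") (auto simp: mult.commute)
qed

lemma J_sum: "(\<And>x. x \<in> X \<Longrightarrow> f x \<in> J) \<Longrightarrow> sum f X \<in> J"
  by (induction X rule: infinite_finite_induct) (auto intro: J_closed)

section \<open>Elements of the algebra A\<close>

text \<open>Expanding the product, the diagonal terms give \<open>P (f * g)\<close> and the mixed
  terms lie in J. So P is multiplicative modulo J.\<close>

lemma P_mult: "f \<in> I \<Longrightarrow> g \<in> I \<Longrightarrow> \<exists>j\<in>J. P f * P g = P (f * g) + j"
proof -
  assume fg: "f \<in> I" "g \<in> I"
  let ?j = "\<Sum>i\<in>{1..r}. \<Sum>l\<in>{1..r} - {i}. \<phi> i f * \<phi> l g"
  have "P f * P g = (\<Sum>i\<in>{1..r}. \<Sum>l\<in>{1..r}. \<phi> i f * \<phi> l g)"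
    by (simp add: phi_sum_def sum_product)
  also have "\<dots> = (\<Sum>i\<in>{1..r}. \<phi> i (f * g) + (\<Sum>l\<in>{1..r} - {i}. \<phi> i f * \<phi> l g))"
  proof (rule sum.cong[OF refl])
    fix i assume i: "i \<in> {1..r}"
    show "(\<Sum>l\<in>{1..r}. \<phi> i f * \<phi> l g) =
        \<phi> i (f * g) + (\<Sum>l\<in>{1..r} - {i}. \<phi> i f * \<phi> l g)"
      by (simp only: sum.remove[OF finite_atLeastAtMost i] k_algebra_hom.hom_mult[OF hom[OF i]])
  qed
  also have "\<dots> = P (f * g) + ?j"
    by (simp add: phi_sum_def sum.distrib)
  finally show ?thesis
    using fg by (intro bexI[of _ ?j]) (auto intro!: J_sum phi_product_in_J)
qed

lemma phi_linear:
  assumes "i \<in> {1..r}"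
  shows "\<phi> i (f + g) = \<phi> i f + \<phi> i g" and "\<phi> i (sc c f) = lscale c (\<phi> i f)"
    and "\<phi> i 0 = 0"
proof -
  interpret h: k_algebra_hom sc lscale "\<phi> i" using assms by (rule hom)
  show "\<phi> i (f + g) = \<phi> i f + \<phi> i g" "\<phi> i (sc c f) = lscale c (\<phi> i f)" "\<phi> i 0 = 0"
    by (rule h.add h.scale h.zero)+
qed

lemma P_add: "P (f + g) = P f + P g"
  unfolding phi_sum_def sum.distrib[symmetric]
  by (intro sum.cong refl phi_linear)

lemma P_scale: "P (sc c f) = lscale c (P f)"
proof -
  interpret L: k_algebra "lscale :: 'k \<Rightarrow> ('n, 'k) laurent \<Rightarrow> _" by (rule k_algebra_lscale)
  show ?thesis
    unfolding phi_sum_def L.scale_sum_right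
    by (intro sum.cong refl phi_linear)
qed

lemma I_closed: "0 \<in> I" "f \<in> I \<Longrightarrow> g \<in> I \<Longrightarrow> f + g \<in> I" "f \<in> I \<Longrightarrow> b * f \<in> I"
  using ideal unfolding ideal_of_def by auto

lemma I_scale: "f \<in> I \<Longrightarrow> sc c f \<in> I"
  using I_closed(3)[of f "sc c 1"] by (simp add: scale_mult_left)

lemma P_in_B: "f \<in> I \<Longrightarrow> P f \<in> B"
proof -
  assume "f \<in> I"
  then have "(\<Sum>i\<in>X. \<phi> i f) \<in> B" if "X \<subseteq> {1..r}" for X
    using that by (induction X rule: infinite_finite_induct) (auto intro!: B_closed zero_in_B phi_in_B)
  then show ?thesis unfolding phi_sum_def by blast
qed

text \<open>The sums of a scalar, an element of P(I) and an element of J form a subalgebra, because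
  P is multiplicative modulo J. It contains the generators of A.\<close>

lemma A_elements:
  assumes "F \<in> A"
  shows "\<exists>c. \<exists>f\<in>I. \<exists>j\<in>J. F = lscale c 1 + P f + j"
proof -
  interpret L: k_algebra "lscale :: 'k \<Rightarrow> ('n, 'k) laurent \<Rightarrow> _" by (rule k_algebra_lscale)
  let ?T = "{lscale c 1 + P f + j | c f j. f \<in> I \<and> j \<in> J}"
  have mem: "lscale c 1 + P f + j \<in> ?T" if "f \<in> I" "j \<in> J" for c f j
    using that by blast
  have P0: "P 0 = 0" using P_scale[of 0 0] by simp
  have "generated_subalgebra lscale (P ` \<rho> ` {1..N}) \<subseteq> ?T"
    unfolding generated_subalgebra_def
  proof (rule hull_minimal)
    show "P ` \<rho> ` {1..N} \<subseteq> ?T"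
    proof
      fix F assume "F \<in> P ` \<rho> ` {1..N}"
      then obtain f where "f \<in> I" "F = P f" using gens by auto
      then show "F \<in> ?T" using mem[of f 0 0] J_closed(1) by simp
    qed
    have "1 \<in> ?T" using mem[of 0 0 1] P0 I_closed(1) J_closed(1) by simp
    moreover have "F + G \<in> ?T \<and> F * G \<in> ?T" if FG: "F \<in> ?T" "G \<in> ?T" for F G
    proof -
      obtain c f j where F: "F = lscale c 1 + P f + j" "f \<in> I" "j \<in> J" using FG(1) by blast
      obtain d g k where G: "G = lscale d 1 + P g + k" "g \<in> I" "k \<in> J" using FG(2) by blast
      have add: "F + G = lscale (c + d) 1 + P (f + g) + (j + k)"
        by (simp add: F G P_add L.scale_left_distrib)
      obtain l where l: "l \<in> J" "P f * P g = P (f * g) + l"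
        using P_mult[OF F(2) G(2)] by blast
      have in_B: "lscale c 1 + P f \<in> B" "G \<in> B"
        unfolding G using F G J_subset_B by (auto intro!: B_closed P_in_B)
      \<comment> \<open>All terms with a factor j or k are collected in the last bracket; their
        cofactors lie in B, so the bracket lies in J.\<close>
      have "F * G = lscale c 1 * lscale d 1 + lscale c 1 * P g + lscale d 1 * P f + P f * P g
          + ((lscale c 1 + P f) * k + G * j)"
        by (simp add: F(1) G(1) algebra_simps)
      also have "\<dots> = lscale (c * d) 1 + P (sc c g + sc d f + f * g)
          + (l + ((lscale c 1 + P f) * k + G * j))"
        by (simp add: l P_add P_scale L.scale_mult_left algebra_simps)
      finally have mult: "F * G = lscale (c * d) 1 + P (sc c g + sc d f + f * g)
          + (l + ((lscale c 1 + P f) * k + G * j))" .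
      have "l + ((lscale c 1 + P f) * k + G * j) \<in> J"
        using in_B F G l by (intro J_closed)
      moreover have "sc c g + sc d f + f * g \<in> I"
        using F G by (intro I_closed I_scale)
      ultimately have "F * G \<in> ?T" unfolding mult by (intro mem)
      moreover have "F + G \<in> ?T"
        unfolding add using F G by (intro mem I_closed J_closed)
      ultimately show ?thesis by blast
    qed
    moreover have "lscale a F \<in> ?T" if F_mem: "F \<in> ?T" for a F
    proof -
      obtain c f j where F: "F = lscale c 1 + P f + j" "f \<in> I" "j \<in> J" using F_mem by blast
      have "lscale a F = lscale (a * c) 1 + P (sc a f) + lscale a 1 * j"
        by (simp add: F P_scale L.scale_right_distrib L.scale_mult_left)
      then show ?thesis
        using mem[OF I_scale[OF F(2)] J_closed(3)[OF B_closed(4)[OF B_closed(1)] F(3)]] by simp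
    qed
    ultimately show "subalgebra lscale ?T"
      unfolding subalgebra_def by blast
  qed
  moreover obtain a b where "F = a + b" "a \<in> generated_subalgebra lscale (P ` \<rho> ` {1..N})" "b \<in> J"
    using assms unfolding algA_def by blast
  ultimately obtain c f j where "F = lscale c 1 + P f + j + b" "f \<in> I" "j \<in> J" by blast
  then show ?thesis
    using \<open>b \<in> J\<close> J_closed(2)[of j b] by (metis add.assoc)
qed

lemma A_subset_B: "A \<subseteq> B"
proof
  fix F assume "F \<in> A"
  then obtain c f j where "F = lscale c 1 + P f + j" "f \<in> I" "j \<in> J"
    using A_elements by blast
  then show "F \<in> B" using J_subset_B by (auto intro!: B_closed P_in_B)
qed

lemma J_subset_A: "J \<subseteq> A"
proof
  fix j assume "j \<in> J"
  moreover have "0 \<in> generated_subalgebra lscale (P ` \<rho> ` {1..N})"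
    using ideal_of_subalgebra_self[OF subalgebra_generated_subalgebra] unfolding ideal_of_def by blast
  ultimately show "j \<in> A" unfolding algA_def by force
qed

section \<open>Degrees of A and the valuations on R\<close>

lemma D_in_cone: "d \<in> D \<Longrightarrow> real_vec d \<in> C"
  using A_subset_B B_supported deg_in_keys unfolding deg_set_def supported_def by blast

lemma phi_eq_0_iff: "i \<in> {1..r} \<Longrightarrow> \<phi> i f = 0 \<longleftrightarrow> f = 0"
  using inj[of i] phi_linear(3)[of i] by (metis injD)

lemma valuation_v: "i \<in> {1..r} \<Longrightarrow> valuation (v i)"
  by (rule valuation_deg[OF hom inj])

lemma v_in_keys: "i \<in> {1..r} \<Longrightarrow> f \<noteq> 0 \<Longrightarrow> v i f \<in> Poly_Mapping.keys (\<phi> i f)"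
  by (simp add: deg_in_keys phi_eq_0_iff)

lemma v_face_circ: "i \<in> {1..r} \<Longrightarrow> f \<in> I - {0} \<Longrightarrow> real_vec (v i f) \<in> face_circ r Cf i"
  using phi_supported[of i f] v_in_keys[of i f] unfolding supported_def by blast

lemma v_in_face: "i \<in> {1..r} \<Longrightarrow> f \<in> I - {0} \<Longrightarrow> real_vec (v i f) \<in> Cf i"
  using v_face_circ unfolding face_circ_def by blast

lemma v_disjoint:
  assumes "i \<in> {1..r}" "l \<in> {1..r}" "i \<noteq> l" "f \<in> I - {0}" "g \<in> I - {0}"
  shows "v i f \<noteq> v l g"
proof
  assume "v i f = v l g"
  moreover have "real_vec (v i f) \<notin> Cf l"
    using assms v_face_circ[of i f] unfolding face_circ_def by auto
  ultimately show False using v_in_face[of l g] assms by simp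
qed

lemma v_add_in_D:
  assumes "i \<in> {1..r}" "l \<in> {1..r}" "i \<noteq> l" "f \<in> I - {0}" "g \<in> I - {0}"
  shows "v i f + v l g \<in> D"
proof -
  have nz: "\<phi> i f \<noteq> 0" "\<phi> l g \<noteq> 0" using assms by (auto simp: phi_eq_0_iff)
  have "\<phi> i f * \<phi> l g \<in> A - {0}"
    using assms J_subset_A deg_mult(2)[OF nz] by (auto intro!: phi_product_in_J)
  then show ?thesis unfolding deg_set_def deg_mult(1)[OF nz, symmetric] by blast
qed

text \<open>At a nonzero exponent in the face \<open>Cf i\<close>, neither the constant, nor J, nor
  any other \<open>\<phi> l f\<close> contributes to F. Hence d is an exponent of
  \<open>\<phi> i f\<close>, and this same f is the required element.\<close>

lemma D_face:
  assumes i: "i \<in> {1..r}" and d: "d \<in> D" "d \<noteq> 0" "real_vec d \<in> Cf i"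
  shows "\<exists>h\<in>I - {0}. v i h = d \<and> (\<forall>l\<in>{1..r} - {i}. v l h \<sqsubset> v i h)"
proof -
  obtain F where F: "F \<in> A" "F \<noteq> 0" "d = deg le F"
    using d(1) unfolding deg_set_def by blast
  obtain c f j where f: "f \<in> I" and j: "j \<in> J" and F_eq: "F = lscale c 1 + P f + j"
    using A_elements[OF F(1)] by blast
  have lookup: "Poly_Mapping.lookup F x = Poly_Mapping.lookup (\<phi> l f) x"
    if x: "real_vec x \<in> Cf l" "x \<noteq> 0" and l: "l \<in> {1..r}" for x l
  proof -
    have "Poly_Mapping.lookup (\<phi> m f) x = 0" if m: "m \<in> {1..r} - {l}" for m
    proof (rule ccontr)
      assume "Poly_Mapping.lookup (\<phi> m f) x \<noteq> 0"
      then have "real_vec x \<in> face_circ r Cf m"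
        using m phi_supported[of m f] f unfolding supported_def by (auto simp: in_keys_iff)
      then show False using m x l unfolding face_circ_def by auto
    qed
    then have "Poly_Mapping.lookup (P f) x = Poly_Mapping.lookup (\<phi> l f) x"
      unfolding phi_sum_def sum.remove[OF finite_atLeastAtMost l]
      by (simp add: lookup_add Poly_Mapping.lookup_sum)
    moreover have "x \<notin> Poly_Mapping.keys j"
    proof
      assume "x \<in> Poly_Mapping.keys j"
      then have "real_vec x \<in> cone_circ r C Cf"
        using j J_supported unfolding supported_def by blast
      then show False using x l unfolding cone_circ_def by auto
    qed
    ultimately show ?thesis
      using x(2) by (simp add: F_eq lookup_add lookup_lscale in_keys_iff lookup_one when_def)
  qed
  \<comment> \<open>Nothing cancels: every exponent of every \<open>\<phi> l f\<close> survives in F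
    and is therefore at most d.\<close>
  have keys: "x \<in> Poly_Mapping.keys F" if "x \<in> Poly_Mapping.keys (\<phi> l f)" "l \<in> {1..r}" for x l
  proof -
    have "real_vec x \<in> Cf l"
      using phi_supported[OF that(2) f] that(1) unfolding supported_def face_circ_def by auto
    moreover have "x \<noteq> 0" using zero_notin_keys_phi[OF that(2) f] that(1) by metis
    ultimately show ?thesis using lookup that by (simp add: in_keys_iff)
  qed
  have "d \<in> Poly_Mapping.keys (\<phi> i f)"
    using deg_in_keys[OF F(2)] lookup[OF d(3,2) i] F(3) by (simp add: in_keys_iff)
  then have vi: "v i f = d" and nz: "f \<in> I - {0}"
    using keys keys_le_deg[OF F(2)] F(3) i f phi_linear(3)[OF i] by (auto intro!: deg_eqI)
  moreover have "v l f \<sqsubset> v i f" if "l \<in> {1..r} - {i}" for l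
  proof -
    have "v l f \<sqsubseteq> v i f"
      unfolding vi F(3) using that nz by (intro keys_le_deg[OF F(2)] keys[of _ l] v_in_keys) auto
    moreover have "v l f \<noteq> v i f" using that i nz by (intro v_disjoint) auto
    ultimately show ?thesis by (simp add: lt_def)
  qed
  ultimately show ?thesis by blast
qed

lemma sum_mset_face:
  assumes "i \<in> {1..r}" "\<And>s. s \<in># M \<Longrightarrow> real_vec s \<in> C"
  shows "real_vec (sum_mset M) \<in> C"
    and "real_vec (sum_mset M) \<in> Cf i \<longleftrightarrow> (\<forall>s\<in>#M. real_vec s \<in> Cf i)"
proof -
  have "real_vec (sum_mset M) \<in> C \<and>
      (real_vec (sum_mset M) \<in> Cf i \<longleftrightarrow> (\<forall>s\<in>#M. real_vec s \<in> Cf i))"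
    using assms(2)
  proof (induction M)
    case empty
    show ?case using zero_in_cone zero_in_face[OF assms(1)] by simp
  next
    case (add x M)
    then show ?case
      using convex_cone_add[OF cone] add_in_face_iff[OF assms(1), of "real_vec x" "real_vec (sum_mset M)"]
      by (simp add: real_vec_add)
  qed
  then show "real_vec (sum_mset M) \<in> C"
    and "real_vec (sum_mset M) \<in> Cf i \<longleftrightarrow> (\<forall>s\<in>#M. real_vec s \<in> Cf i)" by blast+
qed

text \<open>When S generates D, these generate the part of D in the face, since a sum of points of C
  lies in a face only if all summands do.\<close>

definition face_gens :: "(int ^ 'n) set \<Rightarrow> nat \<Rightarrow> (int ^ 'n) set"
  where "face_gens S i = {s \<in> S - {0}. real_vec s \<in> Cf i}"

section \<open>Consequences of finite generation\<close>

context
  fixes S :: "(int ^ 'n) set"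
  assumes finite_S: "finite S" and hull_S: "submonoid hull S = D"
begin

lemma S_subset_D: "S \<subseteq> D"
  using hull_subset[of S submonoid] hull_S by simp

lemma submonoid_D: "submonoid D"
  unfolding hull_S[symmetric] by (rule hull_in) (auto simp: submonoid_def)

lemma sum_mset_in_D: "set_mset M \<subseteq> S \<Longrightarrow> sum_mset M \<in> D"
  using submonoid_D S_subset_D by (induction M) (auto simp: submonoid_def)

text \<open>Fix \<open>g\<^sub>0\<close> and \<open>l \<noteq> i\<close> and write \<open>v i f + v l g\<^sub>0\<close> as a sum of generators. Two such
  decompositions of which one contains the other differ by generators in the face \<open>Cf i\<close>, and by
  Dickson's lemma finitely many decompositions are minimal.\<close>

lemma finite_face_cover:
  assumes i: "i \<in> {1..r}" and X: "X \<subseteq> I - {0}"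
  shows "\<exists>F\<subseteq>X. finite F \<and>
    (\<forall>f\<in>X. \<exists>g\<in>F. \<exists>M. set_mset M \<subseteq> face_gens S i \<and> v i f = v i g + sum_mset M)"
proof (cases "X = {}")
  case False
  then obtain g0 where g0: "g0 \<in> I - {0}" using X by blast
  obtain l where l: "l \<in> {1..r}" "l \<noteq> i" using exists_other_index[OF i] by blast
  \<comment> \<open>A value \<open>v i f\<close> need not be in D. The fixed summand
    \<open>v l g0\<close> moves it into D and cancels in the end.\<close>
  have "\<exists>M. set_mset M \<subseteq> S - {0} \<and> v i f + v l g0 = sum_mset M" if "f \<in> X" for f
  proof (rule mem_submonoid_hull_imp_sum_mset)
    show "v i f + v l g0 \<in> submonoid hull S"
      unfolding hull_S using that X g0 i l by (intro v_add_in_D) auto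
  qed
  then obtain W where W: "\<And>f. f \<in> X \<Longrightarrow> set_mset (W f) \<subseteq> S - {0}"
      "\<And>f. f \<in> X \<Longrightarrow> v i f + v l g0 = sum_mset (W f)" by metis
  obtain Y where Y: "Y \<subseteq> W ` X" "finite Y"
      "\<And>M. M \<in> W ` X \<Longrightarrow> \<exists>L\<in>Y. \<forall>s\<in>S. count L s \<le> count M s"
    using dickson_multiset[OF finite_S, of "W ` X"] by blast
  obtain F where F: "F \<subseteq> X" "finite F" "Y = W ` F"
    using finite_subset_image[OF Y(2,1)] by blast
  have "\<exists>g\<in>F. \<exists>M. set_mset M \<subseteq> face_gens S i \<and> v i f = v i g + sum_mset M" if f: "f \<in> X" for f
  proof -
    obtain g where g: "g \<in> F" "\<And>s. s \<in> S \<Longrightarrow> count (W g) s \<le> count (W f) s"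
      using Y(3)[OF imageI[OF f]] F(3) by blast
    have gX: "g \<in> X" using g(1) F(1) by blast
    have "count (W g) s \<le> count (W f) s" for s
    proof (cases "s \<in> S")
      case False
      then have "s \<notin># W g" using W(1)[OF gX] by auto
      then show ?thesis by (simp add: not_in_iff)
    qed (rule g(2))
    then have "W g \<subseteq># W f" by (rule mset_subset_eqI)
    then obtain M where M: "W f = W g + M" by (metis mset_subset_eq_exists_conv)
    have MS: "set_mset M \<subseteq> S - {0}" using W(1)[OF f] M by auto
    then have MC: "\<And>s. s \<in># M \<Longrightarrow> real_vec s \<in> C" using S_subset_D D_in_cone by blast
    have eq: "v i f = v i g + sum_mset M"
    proof (rule add_right_imp_eq)
      show "v i f + v l g0 = v i g + sum_mset M + v l g0"
        using W(2)[OF f] W(2)[OF gX, symmetric] M by (simp add: add_ac)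
    qed
    \<comment> \<open>The total is \<open>v i f\<close>, a point of the face, so the summand M is in
      the face too.\<close>
    have "real_vec (v i g) + real_vec (sum_mset M) \<in> Cf i"
      using v_in_face[OF i, of f] f X unfolding eq real_vec_add by blast
    then have "real_vec (sum_mset M) \<in> Cf i"
      using add_in_face_iff[OF i] v_in_face[OF i, of g] face_subset[OF i] gX X sum_mset_face(1)[OF i MC]
      by blast
    then have "set_mset M \<subseteq> face_gens S i"
      using sum_mset_face(2)[OF i MC] MS unfolding face_gens_def by blast
    with eq g(1) show ?thesis by blast
  qed
  with F show ?thesis by blast
qed auto

text \<open>Apply the finite cover to the powers of f. The base points are finitely many powers, so
  a higher power differs from one of them by a positive multiple of \<open>v i f\<close>.\<close>

lemma v_multiple_in_face_gens:
  assumes i: "i \<in> {1..r}" and f: "f \<in> I - {0}"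
  shows "\<exists>m>0. \<exists>M. set_mset M \<subseteq> face_gens S i \<and> nat_mult m (v i f) = sum_mset M"
proof -
  \<comment> \<open>Exponents start at 1, since \<open>f ^ 0\<close> need not lie in I.\<close>
  have pow: "f ^ Suc n \<in> I - {0}" for n
    using f I_closed(3)[of f "f ^ n"] by (simp add: mult.commute)
  have v_pow: "v i (f ^ Suc n) = nat_mult (Suc n) (v i f)" for n
  proof (induction n)
    case (Suc n)
    then show ?case
      using f pow[of n] by (subst power_Suc) (simp add: valuation_mult[OF valuation_v[OF i]] del: power_Suc)
  qed simp
  have powers: "range (\<lambda>n. f ^ Suc n) \<subseteq> I - {0}"
    using pow by (rule image_subsetI)
  obtain F where F: "F \<subseteq> range (\<lambda>n. f ^ Suc n)" "finite F"
      and cover: "\<forall>h\<in>range (\<lambda>n. f ^ Suc n). \<exists>g\<in>F. \<exists>M. set_mset M \<subseteq> face_gens S i \<and>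
        v i h = v i g + sum_mset M"
    using finite_face_cover[OF i powers] by (elim exE conjE) (rule that)
  obtain K where K: "finite K" "F = (\<lambda>n. f ^ Suc n) ` K"
    using finite_subset_image[OF F(2,1)] by (elim exE conjE) (rule that)
  obtain n where n: "\<forall>k\<in>K. k < n"
    using K(1) unfolding finite_nat_set_iff_bounded by (elim exE) (rule that)
  obtain g M where g: "g \<in> F" "set_mset M \<subseteq> face_gens S i" "v i (f ^ Suc n) = v i g + sum_mset M"
    using bspec[OF cover rangeI[where x = n]] by (elim bexE exE conjE) (rule that)
  obtain k where k: "k \<in> K" "g = f ^ Suc k"
    using g(1) unfolding K(2) by (elim imageE) (rule that)
  have "nat_mult (Suc n) (v i f) = nat_mult (Suc k) (v i f) + nat_mult (n - k) (v i f)"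
    using bspec[OF n k(1)] nat_mult_add[of "Suc k" "n - k" "v i f"] by simp
  then have "nat_mult (n - k) (v i f) = sum_mset M"
    using g(3) unfolding k(2) v_pow by simp
  then show ?thesis using g(2) bspec[OF n k(1)] by (intro exI[of _ "n - k"]) auto
qed

section \<open>Positivity and the reduction to two competing valuations\<close>

context
  fixes i\<^sub>0 :: nat
  assumes i0: "i\<^sub>0 \<in> {1..r}" and v_i0_nonneg: "\<And>f. f \<noteq> 0 \<Longrightarrow> 0 \<sqsubseteq> v i\<^sub>0 f"
begin

text \<open>Only the valuation with index \<open>i\<^sub>0\<close> is nonnegative by hypothesis. A
  generator in another face is a value \<open>v i h\<close> exceeding \<open>v i\<^sub>0 h\<close>,
  so it inherits the sign.\<close>

lemma face_gens_pos:
  assumes i: "i \<in> {1..r}" and s: "s \<in> face_gens S i"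
  shows "0 \<sqsubset> s"
proof -
  have "s \<in> D" "s \<noteq> 0" "real_vec s \<in> Cf i"
    using s S_subset_D by (auto simp: face_gens_def)
  from D_face[OF i this] obtain h where h: "h \<in> I - {0}" "v i h = s"
      "\<And>l. l \<in> {1..r} - {i} \<Longrightarrow> v l h \<sqsubset> v i h"
    by blast
  have "0 \<sqsubseteq> s"
    using h v_i0_nonneg[of h] i0 by (cases "i = i\<^sub>0") (auto simp: lt_def intro: le_trans)
  then show ?thesis using s by (auto simp: face_gens_def lt_def)
qed

text \<open>A positive multiple of the value is a sum of positive generators, so the value is not
  negative. It is not 0, as 0 is no exponent of \<open>\<phi> i f\<close>.\<close>

lemma v_pos:
  assumes i: "i \<in> {1..r}" and f: "f \<in> I - {0}"
  shows "0 \<sqsubset> v i f"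
proof -
  obtain m M where m: "m > 0" "set_mset M \<subseteq> face_gens S i" "nat_mult m (v i f) = sum_mset M"
    using v_multiple_in_face_gens[OF i f] by blast
  have "0 \<sqsubseteq> sum_mset M"
    using m(2) face_gens_pos[OF i] by (intro sum_mset_nonneg) (auto simp: lt_def)
  then have "\<not> v i f \<sqsubset> 0"
    using nat_mult_neg[OF _ m(1), of "v i f"] m(3) og.leD by auto
  moreover have "v i f \<noteq> 0"
    using zero_notin_keys_phi[OF i, of f] v_in_keys[OF i, of f] f by auto
  ultimately show ?thesis using le_total[of 0 "v i f"] by (auto simp: lt_def)
qed

lemma face_gens_nonempty:
  assumes i: "i \<in> {1..r}"
  shows "face_gens S i \<noteq> {}"
proof -
  obtain f where f: "f \<in> I - {0}" using I_nonzero I_closed(1) by blast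
  obtain m M where m: "m > 0" "set_mset M \<subseteq> face_gens S i" "nat_mult m (v i f) = sum_mset M"
    using v_multiple_in_face_gens[OF i f] by blast
  have "M \<noteq> {#}"
    using nat_mult_pos[OF v_pos[OF i f] m(1)] m(3) by auto
  then show ?thesis using m(2) by auto
qed

text \<open>On the elements whose two values are bounded by multiples of the smallest generator
  \<open>\<delta>\<close> there are only finitely many values up to any multiple of \<open>\<delta>\<close>.\<close>

lemma hull_neq_degrees: False
proof -
  obtain i\<^sub>1 where i1: "i\<^sub>1 \<in> {1..r}" "i\<^sub>1 \<noteq> i\<^sub>0" using exists_other_index[OF i0] by blast
  define T where "T = face_gens S i\<^sub>0 \<union> face_gens S i\<^sub>1"
  have fin_T: "finite T" using finite_S unfolding T_def face_gens_def by auto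
  obtain \<delta> where \<delta>: "\<delta> \<in> T" "\<And>t. t \<in> T \<Longrightarrow> \<delta> \<sqsubseteq> t"
    using finite_has_min[OF fin_T] face_gens_nonempty[OF i0] unfolding T_def by blast
  have \<delta>_pos: "0 \<sqsubset> \<delta>"
    using \<delta>(1) face_gens_pos i0 i1 unfolding T_def by blast
  \<comment> \<open>The order may be non-archimedean. Restricting to values bounded by multiples of
    \<open>\<delta>\<close> makes the archimedean condition hold by construction.\<close>
  define V where "V = {f \<in> I. f = 0 \<or> (\<exists>n. v i\<^sub>0 f \<sqsubseteq> nat_mult n \<delta> \<and> v i\<^sub>1 f \<sqsubseteq> nat_mult n \<delta>)}"
  have V_sub: "V \<subseteq> I" unfolding V_def by blast
  have val: "valuation (v i\<^sub>0)" "valuation (v i\<^sub>1)"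
    using i0 i1 valuation_v by auto
  have sub: "subspace V"
  proof (rule subspaceI)
    show "0 \<in> V" using I_closed(1) by (simp add: V_def)
    let ?L = "\<lambda>n i. {f. f = 0 \<or> v i f \<sqsubseteq> nat_mult n \<delta>}"
    have V_iff: "f \<in> V \<longleftrightarrow> f \<in> I \<and> (\<exists>n. f \<in> ?L n i\<^sub>0 \<and> f \<in> ?L n i\<^sub>1)" for f
      unfolding V_def by auto
    have mono: "?L m i \<subseteq> ?L n i" if "m \<le> n" for m n i
      using nat_mult_mono[OF _ that, of \<delta>] \<delta>_pos le_trans unfolding lt_def by blast
    show "f + g \<in> V" if fg: "f \<in> V" "g \<in> V" for f g
    proof -
      obtain n m where nm: "f \<in> ?L n i\<^sub>0 \<inter> ?L n i\<^sub>1" "g \<in> ?L m i\<^sub>0 \<inter> ?L m i\<^sub>1"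
        using fg unfolding V_iff by blast
      let ?k = "max n m"
      have "f \<in> ?L ?k i\<^sub>0 \<inter> ?L ?k i\<^sub>1" "g \<in> ?L ?k i\<^sub>0 \<inter> ?L ?k i\<^sub>1"
        using nm mono[of n ?k] mono[of m ?k] by (meson IntE IntI max.cobounded1 max.cobounded2 subsetD)+
      then have "f + g \<in> ?L ?k i\<^sub>0" "f + g \<in> ?L ?k i\<^sub>1"
        using subspace_add[OF subspace_valuation_le[OF val(1)], of f "nat_mult ?k \<delta>" g]
          subspace_add[OF subspace_valuation_le[OF val(2)], of f "nat_mult ?k \<delta>" g] by blast+
      then show ?thesis using fg I_closed(2) unfolding V_iff by blast
    qed
    show "sc c f \<in> V" if f: "f \<in> V" for c f
    proof -
      obtain n where "f \<in> ?L n i\<^sub>0" "f \<in> ?L n i\<^sub>1" using f unfolding V_iff by blast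
      then have "sc c f \<in> ?L n i\<^sub>0" "sc c f \<in> ?L n i\<^sub>1"
        using subspace_scale[OF subspace_valuation_le[OF val(1)], of f "nat_mult n \<delta>" c]
          subspace_scale[OF subspace_valuation_le[OF val(2)], of f "nat_mult n \<delta>" c] by blast+
      then show ?thesis using f I_scale unfolding V_iff by blast
    qed
  qed
  have mult: "f * g \<in> V" if fg: "f \<in> V" "g \<in> V" for f g
  proof (cases "f = 0 \<or> g = 0")
    case True
    then show ?thesis using I_closed(1) by (auto simp: V_def)
  next
    case False
    then obtain n m where "v i\<^sub>0 f \<sqsubseteq> nat_mult n \<delta>" "v i\<^sub>1 f \<sqsubseteq> nat_mult n \<delta>"
        "v i\<^sub>0 g \<sqsubseteq> nat_mult m \<delta>" "v i\<^sub>1 g \<sqsubseteq> nat_mult m \<delta>"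
      using fg unfolding V_def by blast
    then have "v i\<^sub>0 (f * g) \<sqsubseteq> nat_mult (n + m) \<delta> \<and> v i\<^sub>1 (f * g) \<sqsubseteq> nat_mult (n + m) \<delta>"
      using False by (simp add: valuation_mult[OF val(1)] valuation_mult[OF val(2)] nat_mult_add og.add_mono)
    moreover have "f * g \<in> I" using fg(2) I_closed(3) V_sub by blast
    ultimately show ?thesis unfolding V_def by blast
  qed
  have cover: "\<exists>F\<subseteq>V - {0}. finite F \<and> (\<forall>f\<in>V - {0}. \<exists>g\<in>F. \<exists>M. set_mset M \<subseteq> T \<and>
      v a f = v a g + sum_mset M \<and>
      (M = {#} \<or> (\<exists>h\<in>V - {0}. v a h = sum_mset M \<and> v b h \<sqsubset> v a h)))"
    if ab: "a = i\<^sub>0 \<and> b = i\<^sub>1 \<or> a = i\<^sub>1 \<and> b = i\<^sub>0" for a b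
  proof -
    have a: "a \<in> {1..r}" and b: "b \<in> {1..r} - {a}" using ab i0 i1 by auto
    obtain F where F: "F \<subseteq> V - {0}" "finite F"
        "\<And>f. f \<in> V - {0} \<Longrightarrow> \<exists>g\<in>F. \<exists>M. set_mset M \<subseteq> face_gens S a \<and> v a f = v a g + sum_mset M"
      using finite_face_cover[OF a, of "V - {0}"] V_sub by blast
    \<comment> \<open>The sum of M is a nonzero element of D in the face, so \<open>D_face\<close>
      yields h. It stays in V because \<open>v b h\<close> is below \<open>v a h\<close>, which is
      at most \<open>v a f\<close>.\<close>
    have "\<exists>h\<in>V - {0}. v a h = sum_mset M \<and> v b h \<sqsubset> v a h"
      if f: "f \<in> V - {0}" and g: "g \<in> F" and M: "set_mset M \<subseteq> face_gens S a" "M \<noteq> {#}"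
        and eq: "v a f = v a g + sum_mset M" for f g M
    proof -
      have MS: "set_mset M \<subseteq> S" using M(1) unfolding face_gens_def by blast
      have "real_vec (sum_mset M) \<in> Cf a"
        using sum_mset_face(2)[OF a, of M] M(1) MS S_subset_D D_in_cone unfolding face_gens_def by blast
      moreover have "0 \<sqsubset> sum_mset M"
        using M face_gens_pos[OF a] by (intro sum_mset_pos) auto
      ultimately obtain h where h: "h \<in> I - {0}" "v a h = sum_mset M"
          "\<And>l. l \<in> {1..r} - {a} \<Longrightarrow> v l h \<sqsubset> v a h"
        using D_face[OF a sum_mset_in_D[OF MS]] by (metis lt_def)
      obtain n where n: "v a f \<sqsubseteq> nat_mult n \<delta>"
        using f ab unfolding V_def by blast
      have "0 \<sqsubset> v a g" using g F(1) V_sub by (intro v_pos[OF a]) blast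
      then have "v a h \<sqsubseteq> v a f" unfolding eq h(2) by (simp add: lt_def)
      then have "v a h \<sqsubseteq> nat_mult n \<delta>" "v b h \<sqsubseteq> nat_mult n \<delta>"
        using n h(3)[OF b] le_trans unfolding lt_def by blast+
      then have "h \<in> V" using h(1) ab unfolding V_def by blast
      then show ?thesis using h b by blast
    qed
    moreover have "face_gens S a \<subseteq> T" using ab unfolding T_def by blast
    ultimately show ?thesis using F by (intro exI[of _ F]) (meson order_trans)
  qed
  obtain F\<^sub>0 where F0: "F\<^sub>0 \<subseteq> V - {0}" "finite F\<^sub>0" "\<forall>f\<in>V - {0}. \<exists>g\<in>F\<^sub>0. \<exists>M. set_mset M \<subseteq> T \<and>
      v i\<^sub>0 f = v i\<^sub>0 g + sum_mset M \<and>
      (M = {#} \<or> (\<exists>h\<in>V - {0}. v i\<^sub>0 h = sum_mset M \<and> v i\<^sub>1 h \<sqsubset> v i\<^sub>0 h))"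
    using cover[of i\<^sub>0 i\<^sub>1] by blast
  obtain F\<^sub>1 where F1: "F\<^sub>1 \<subseteq> V - {0}" "finite F\<^sub>1" "\<forall>f\<in>V - {0}. \<exists>g\<in>F\<^sub>1. \<exists>M. set_mset M \<subseteq> T \<and>
      v i\<^sub>1 f = v i\<^sub>1 g + sum_mset M \<and>
      (M = {#} \<or> (\<exists>h\<in>V - {0}. v i\<^sub>1 h = sum_mset M \<and> v i\<^sub>0 h \<sqsubset> v i\<^sub>1 h))"
    using cover[of i\<^sub>1 i\<^sub>0] by blast
  \<comment> \<open>The generator \<open>\<delta>\<close> is itself the larger value of some h,
    which satisfies the bound with n = 1.\<close>
  have nonzero: "V \<noteq> {0}"
  proof -
    obtain a b where ab: "a = i\<^sub>0 \<and> b = i\<^sub>1 \<or> a = i\<^sub>1 \<and> b = i\<^sub>0" and "\<delta> \<in> face_gens S a"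
      using \<delta>(1) unfolding T_def by blast
    then have a: "a \<in> {1..r}" "b \<in> {1..r} - {a}" "\<delta> \<in> D" "\<delta> \<noteq> 0" "real_vec \<delta> \<in> Cf a"
      using i0 i1 S_subset_D unfolding face_gens_def by auto
    then obtain h where h: "h \<in> I - {0}" "v a h = \<delta>" "v b h \<sqsubset> v a h"
      using D_face[of a \<delta>] by blast
    then have "v a h \<sqsubseteq> nat_mult 1 \<delta>" "v b h \<sqsubseteq> nat_mult 1 \<delta>"
      by (auto simp: lt_def le_refl)
    then have "h \<in> V" using h(1) ab unfolding V_def by blast
    then show ?thesis using h(1) by blast
  qed
  have "valuation_pair le sc V T \<delta> (v i\<^sub>0) (v i\<^sub>1) F\<^sub>0 F\<^sub>1"
  proof unfold_locales
    fix f g assume fg: "f \<in> V - {0}" "g \<in> V - {0}"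
    then show "v i\<^sub>0 f \<noteq> v i\<^sub>1 g" using V_sub i0 i1 by (intro v_disjoint) auto
  next
    fix f assume f: "f \<in> V - {0}"
    then have "f \<in> I - {0}" using V_sub by blast
    then show "0 \<sqsubset> v i\<^sub>0 f" "0 \<sqsubset> v i\<^sub>1 f" using v_pos i0 i1 by blast+
    show "\<exists>n. v i\<^sub>0 f \<sqsubseteq> nat_mult n \<delta> \<and> v i\<^sub>1 f \<sqsubseteq> nat_mult n \<delta>"
      using f unfolding V_def by blast
  qed (use val sub mult nonzero fin_T \<delta>(2) \<delta>_pos F0 F1 in blast)+
  then show False by (rule valuation_pair.inconsistent)
qed

end

end

end

theorem theorem2p4:
  fixes C :: "(real ^ 'n::finite) set"
    and Cf :: "nat \<Rightarrow> (real ^ 'n) set"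
    and r :: nat
    and sc :: "'k::field \<Rightarrow> 'r::idom \<Rightarrow> 'r"
    and I :: "'r set"
    and \<phi> :: "nat \<Rightarrow> 'r \<Rightarrow> ('n, 'k) laurent"
    and U :: "('n, 'k) laurent set"
    and N :: nat
    and \<rho> :: "nat \<Rightarrow> 'r"
    and le :: "int ^ 'n \<Rightarrow> int ^ 'n \<Rightarrow> bool"
  assumes "convex_cone C"
    and "2 \<le> r"
    and "\<And>i. i \<in> {1..r} \<Longrightarrow> cone_face (Cf i) C"
    and "\<And>i j. i \<in> {1..r} \<Longrightarrow> j \<in> {1..r} \<Longrightarrow> i \<noteq> j \<Longrightarrow> \<not> Cf i \<subseteq> Cf j"
    and "k_algebra sc"
    and "finitely_generated_algebra sc"
    and "ideal_of UNIV I"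
    and "I \<noteq> {0}"
    and "UNIV = {sc c 1 + x | c x. x \<in> I}"
    and "\<And>i. i \<in> {1..r} \<Longrightarrow> k_algebra_hom sc lscale (\<phi> i)"
    and "\<And>i. i \<in> {1..r} \<Longrightarrow> inj (\<phi> i)"
    and "\<And>i. i \<in> {1..r} \<Longrightarrow> real_vec ` supp (\<phi> i ` I) \<subseteq> face_circ r Cf i"
    and "finite U"
    and "real_vec ` supp U \<subseteq> cone_circ r C Cf"
    and "1 \<le> N"
    and "\<rho> ` {1..N} \<subseteq> I - {0}"
    and "generated_subalgebra sc (\<rho> ` {1..N}) = UNIV"
    and "le \<in> Omega"
    and "\<exists>i\<in>{1..r}. is_min le (deg_set le (range (\<phi> i))) 0"
  shows "\<not> finitely_generated_monoid (deg_set le (algA r \<phi> I U N \<rho>))"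
proof
  interpret cone_construction le sc C Cf r I \<phi> U N \<rho>
  proof (intro cone_construction.intro laurent_order.intro cone_construction_axioms.intro)
    show "ordered_group le" by (rule Omega_ordered_group) fact
    show "\<rho> ` {1..N} \<subseteq> I" using assms(16) by blast
  qed (fact assms)+
  assume "finitely_generated_monoid D"
  then obtain S where S: "finite S" "submonoid hull S = D"
    unfolding finitely_generated_monoid_def by blast
  obtain i where i: "i \<in> {1..r}" "\<forall>a\<in>deg_set le (range (\<phi> i)). le 0 a"
    using assms(19) unfolding is_min_def by blast
  \<comment> \<open>By injectivity \<open>\<phi> i f\<close> is nonzero, so its degree belongs to
    the set whose minimum is 0.\<close>
  have "le 0 (v i f)" if "f \<noteq> 0" for f
    using i(2) phi_eq_0_iff[OF i(1)] that unfolding deg_set_def by blast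
  then show False using hull_neq_degrees[OF S i(1)] by blast
qed

end
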